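(* Assume $\mathbb A$ is compact and that Monotonicity, Growth bound and Score continuity (see context) hold, so that $\overline{\mathcal R}$ and $\overline{\mathfrak R}$ are well defined. Let $\Psi\in\mathcal P(\mathbb X\times\mathbb A)^{T-1}$ be any mean field flow and $V\in B_b(\mathbb X\times\mathcal P(\mathbb X))$. (a) If Integral bound holds (with constant $\bar c$), then $\overline{\mathcal R}(\Psi;V)\le\overline{\mathfrak R}(\Psi;V)$. (b) Suppose Integral bound holds (with constant $\bar c$) and, in addition, there is $\underline c>0$ such that for all $t\in\{1,\dots,T-1\}$, $\lambda\in\mathcal P(\mathbb A)$, $\xi\in\mathcal P(\mathbb X)$, $x\in\mathbb X$ and $v,v'\in B_b(\mathbb X)$ with $v\ge v'$, $$\mathring{\overline G}v-\mathring{\overline G}v'\ge\underline c\int_{\mathbb X}(v-v')\,d\mathring\xi,\qquad \overline G^\lambda_{t,\xi}v(x)-\overline G^\lambda_{t,\xi}v'(x)\ge\underline c\int_{\mathbb X}(v(y)-v'(y))\,Q^\lambda_{t,x,\xi}(dy).$$ Then $\overline{\mathcal R}(\Psi;V)\ge(\underline c/\bar c)^{T-1}\,\overline{\mathfrak R}(\Psi;V)$.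
   Context: Spaces. $\mathbb X$ and $\mathbb A$ are complete separable metric spaces. For a Polish space $\mathbb Y$, $\mathcal P(\mathbb Y)$ is the set of Borel probability measures with the weak topology; $B_b(\mathbb Y)$ is the set of bounded Borel real functions. All maps are Borel measurable. $\|m\|_{BL}=\sup_h\frac12\int h\,dm$ over $1$-Lipschitz $h:\mathbb Y\to[-1,1]$. A subadditive modulus of continuity is a nondecreasing, subadditive, concave $\beta:[0,\infty]\to[0,\infty]$ with $\lim_{\ell\to0+}\beta(\ell)=0$. Model. $T\ge2$; $P_t:\mathbb X\times\mathcal P(\mathbb X)\times\mathbb A\to\mathcal P(\mathbb X)$, written $P_{t,x,\xi,a}$, $t=1,\dots,T-1$, are transition kernels; $\mathring\xi\in\mathcal P(\mathbb X)$ is the initial law; $Q^\lambda_{t,x,\xi}(B)=\int_{\mathbb A}P_{t,x,\xi,a}(B)\lambda(da)$. $\overline\Pi$ is the set of maps $\mathbb X\to\mathcal P(\mathbb A)$. Score operators. $\overline G^\lambda_{t,\xi}:B_b(\mathbb X)\to B_b(\mathbb X)$ ($t=1,\dots,T-1$, $\lambda\in\mathcal P(\mathbb A)$, $\xi\in\mathcal P(\mathbb X)$) and $\mathring{\overline G}:B_b(\mathbb X)\to\mathbb R$ are given, with $(x,\xi,\lambda)\mapsto\overline G^\lambda_{t,\xi}v(x)$ Borel. For $\overline\pi\in\overline\Pi$, $\overline{\mathfrak p}=(\overline{\mathfrak p}_1,\dots,\overline{\mathfrak p}_{T-1})\in\overline\Pi^{T-1}$, $\Xi=(\xi_1,\dots,\xi_{T-1})\in\mathcal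 P(\mathbb X)^{T-1}$ put $\overline S^{\overline\pi}_{t,\xi}v(x)=\overline G^{\overline\pi_x}_{t,\xi}v(x)$, $\overline S^*_{t,\xi}v(x)=\inf_{\lambda\in\mathcal P(\mathbb A)}\overline G^\lambda_{t,\xi}v(x)$, $\overline{\mathcal S}^{\overline{\mathfrak p}}_{s,t,\Xi}=\overline S^{\overline{\mathfrak p}_s}_{s,\xi_s}\circ\cdots\circ\overline S^{\overline{\mathfrak p}_{t-1}}_{t-1,\xi_{t-1}}$, $\overline{\mathcal S}^*_{s,t,\Xi}=\overline S^*_{s,\xi_s}\circ\cdots\circ\overline S^*_{t-1,\xi_{t-1}}$ (identity if $s=t$), $\overline{\mathbb S}^{\overline{\mathfrak p}}_{T,\Xi}=\mathring{\overline G}\circ\overline{\mathcal S}^{\overline{\mathfrak p}}_{1,T,\Xi}$, $\overline{\mathbb S}^*_{T,\Xi}=\mathring{\overline G}\circ\overline{\mathcal S}^*_{1,T,\Xi}$. Mean field flow. For $\psi\in\mathcal P(\mathbb X\times\mathbb A)$, $\xi^\psi$ is its $\mathbb X$-marginal and $\overline\pi^\psi\in\overline\Pi$ is (a version of) its induced action kernel: $\psi(B\times A)=\int_B\overline\pi^\psi_x(A)\xi^\psi(dx)$. $\Psi=(\psi_1,\dots,\psi_{T-1})$ is a mean field flow if $\xi^{\psi_1}=\mathring\xi$ and $\xi^{\psi_{t+1}}(B)=\int P_{t,y,\xi^{\psi_t},a}(B)\psi_t(dy\,da)$ for all Borel $B$ and $t=1,\dots,T-2$. Put $\Xi^\Psi=(\xi^{\psi_1},\dots,\xi^{\psi_{T-1}})$,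 $\overline{\mathfrak p}^\Psi=(\overline\pi^{\psi_1},\dots,\overline\pi^{\psi_{T-1}})$, $V_\Psi(x)=V\big(x,\int P_{T-1,y,\xi^{\psi_{T-1}},a}(\cdot)\psi_{T-1}(dy\,da)\big)$. Exploitabilities. $\overline{\mathcal R}(\Psi;V)=\overline{\mathbb S}^{\overline{\mathfrak p}^\Psi}_{T,\Xi^\Psi}V_\Psi-\overline{\mathbb S}^*_{T,\Xi^\Psi}V_\Psi$ and $\overline{\mathfrak R}(\Psi;V)=\sum_{t=1}^{T-1}\bar c^{\,t}\int_{\mathbb X}\big(\overline S^{\overline\pi^{\psi_t}}_{t,\xi^{\psi_t}}\circ\overline{\mathcal S}^*_{t+1,T,\Xi^\Psi}V_\Psi-\overline{\mathcal S}^*_{t,T,\Xi^\Psi}V_\Psi\big)d\xi^{\psi_t}$, with $\bar c$ the constant of Integral bound. Assumptions (for all $t,\lambda,\lambda',\xi,\xi',x,v,v'$). Monotonicity: $\mathring{\overline G}$ and $\overline G^\lambda_{t,\xi}$ are nondecreasing. Growth bound: $\|\overline G^\lambda_{t,\xi}v\|_\infty\le c_0+c_1\|v\|_\infty$ for constants $c_0,c_1>0$. Integral bound: there is $\bar c>0$ with $|\mathring{\overline G}v-\mathring{\overline G}v'|\le\bar c\int|v-v'|d\mathring\xi$ and $|\overline G^\lambda_{t,\xi}v(x)-\overline G^\lambda_{t,\xi}v'(x)|\le\bar c\int|v-v'|dQ^\lambda_{t,x,\xi}$. Score continuity: there is a subadditive modulus $\zeta$ with $\|\overline G^\lambda_{t,\xi}v-\overline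 G^{\lambda'}_{t,\xi'}v\|_\infty\le(c_0+c_1\|v\|_\infty)(\zeta(\|\xi-\xi'\|_{BL})+\zeta(\|\lambda-\lambda'\|_{BL}))$. *)

theory Defs
  imports "HOL-Probability.Probability"
begin

section \<open>Spaces of probability measures\<close>

abbreviation borel_probs :: "'y::topological_space measure set" where
  "borel_probs \<equiv> space (prob_algebra borel)"

lemma borel_probs_eq: "borel_probs = {\<mu>. sets \<mu> = sets borel \<and> prob_space \<mu>}"
  by (auto simp: space_prob_algebra)

definition weak_topology :: "'y::polish_space measure topology" where
  "weak_topology = topology_generated_by
     {{\<mu> \<in> borel_probs. (\<integral>y. f y \<partial>\<mu>) \<in> U} | f U.
        continuous_on UNIV (f :: 'y \<Rightarrow> real) \<and> bounded (range f) \<and> open U}"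

lemma topspace_weak_topology: "topspace (weak_topology :: 'y::polish_space measure topology) = borel_probs"
proof -
  let ?S = "{{\<mu> \<in> borel_probs. (\<integral>y. f y \<partial>\<mu>) \<in> U} | f U.
     continuous_on UNIV (f :: 'y \<Rightarrow> real) \<and> bounded (range f) \<and> open U}"
  have "(borel_probs :: 'y measure set) \<in> ?S"
    by (rule CollectI, rule exI[of _ "\<lambda>_. 0"], rule exI[of _ UNIV]) (simp add: image_constant_conv)
  moreover have "\<Union>?S \<subseteq> (borel_probs :: 'y measure set)"
    by blast
  ultimately show ?thesis
    unfolding weak_topology_def topology_generated_by_topspace by (intro equalityI Union_upper)
qed

text \<open>The weak topology of a Polish space is second countable, so the Borel \<open>\<sigma>\<close>-algebra of a
  product such as \<open>\<X> \<times> \<P>(\<X>) \<times> \<A>\<close> is the product \<open>\<sigma>\<close>-algebra; below it is written with \<open>\<Otimes>\<^sub>M\<close>.\<close>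

definition borel_weak :: "'y::polish_space measure measure" where
  "borel_weak = sigma borel_probs {U. openin weak_topology U}"

definition bdd_borel :: "'z measure \<Rightarrow> ('z \<Rightarrow> real) set" where
  "bdd_borel M = {v \<in> borel_measurable M. bounded (v ` space M)}"

definition sup_norm :: "('y \<Rightarrow> real) \<Rightarrow> real" where
  "sup_norm v = (SUP y. \<bar>v y\<bar>)"

text \<open>\<open>\<parallel>\<mu> - \<nu>\<parallel>\<^bsub>BL\<^esub>\<close>, the bounded Lipschitz norm of a difference of probability measures.\<close>

definition bl_dist :: "'y::polish_space measure \<Rightarrow> 'y measure \<Rightarrow> real" where
  "bl_dist \<mu> \<nu> =
     (SUP h \<in> {h :: 'y \<Rightarrow> real. 1-lipschitz_on UNIV h \<and> range h \<subseteq> {-1..1}}.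
        ((\<integral>y. h y \<partial>\<mu>) - (\<integral>y. h y \<partial>\<nu>)) / 2)"

definition subadditive_modulus :: "(ennreal \<Rightarrow> ennreal) \<Rightarrow> bool" where
  "subadditive_modulus \<beta> \<longleftrightarrow>
     mono \<beta> \<and>
     (\<forall>x y. \<beta> (x + y) \<le> \<beta> x + \<beta> y) \<and>
     (\<forall>u x y. 0 \<le> u \<and> u \<le> 1 \<longrightarrow>
        ennreal u * \<beta> x + ennreal (1 - u) * \<beta> y \<le> \<beta> (ennreal u * x + ennreal (1 - u) * y)) \<and>
     (\<beta> \<longlongrightarrow> 0) (at_right 0)"

section \<open>Model\<close>

type_synonym ('x, 'a) transition = "nat \<Rightarrow> 'x \<Rightarrow> 'x measure \<Rightarrow> 'a \<Rightarrow> 'x measure"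

definition transition_kernels :: "nat \<Rightarrow> ('x::polish_space, 'a::polish_space) transition \<Rightarrow> bool" where
  "transition_kernels T P \<longleftrightarrow>
     (\<forall>t\<in>{1..T-1}. (\<lambda>(x, \<xi>, a). P t x \<xi> a) \<in> borel \<Otimes>\<^sub>M (borel_weak \<Otimes>\<^sub>M borel) \<rightarrow>\<^sub>M borel_weak)"

text \<open>The mixture \<open>Q\<^sup>\<lambda>(B) = \<integral> P\<^sub>a(B) \<lambda>(da)\<close> is the Giry bind.\<close>

definition Q_kernel ::
  "('x::polish_space, 'a::polish_space) transition \<Rightarrow> nat \<Rightarrow> 'a measure \<Rightarrow> 'x \<Rightarrow> 'x measure \<Rightarrow> 'x measure" where
  "Q_kernel P t l x \<xi> = l \<bind> (\<lambda>a. P t x \<xi> a)"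

definition action_kernels :: "('x::polish_space \<Rightarrow> 'a::polish_space measure) set" where
  "action_kernels = borel \<rightarrow>\<^sub>M borel_weak"

section \<open>Score operators\<close>

text \<open>\<open>G t l \<xi> v x\<close> is the value at \<open>x\<close> of the operator with randomized action \<open>l\<close> and
  population law \<open>\<xi>\<close>, applied to \<open>v\<close>. Only its values for \<open>v \<in> bdd_borel borel\<close>, laws in
  \<open>borel_probs\<close> and \<open>1 \<le> t \<le> T - 1\<close> are constrained.\<close>

type_synonym ('x, 'a) score = "nat \<Rightarrow> 'a measure \<Rightarrow> 'x measure \<Rightarrow> ('x \<Rightarrow> real) \<Rightarrow> 'x \<Rightarrow> real"

definition score_operators :: "nat \<Rightarrow> ('x::polish_space, 'a::polish_space) score \<Rightarrow> bool" where
  "score_operators T G \<longleftrightarrow>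
     (\<forall>t\<in>{1..T-1}. \<forall>v\<in>bdd_borel borel.
        (\<forall>l\<in>borel_probs. \<forall>\<xi>\<in>borel_probs. G t l \<xi> v \<in> bdd_borel borel) \<and>
        (\<lambda>(x, \<xi>, l). G t l \<xi> v x) \<in> borel_measurable (borel \<Otimes>\<^sub>M (borel_weak \<Otimes>\<^sub>M borel_weak)))"

definition S_op ::
  "('x::polish_space, 'a::polish_space) score \<Rightarrow> nat \<Rightarrow> ('x \<Rightarrow> 'a measure) \<Rightarrow> 'x measure \<Rightarrow> ('x \<Rightarrow> real) \<Rightarrow> 'x \<Rightarrow> real" where
  "S_op G t \<pi> \<xi> v = (\<lambda>x. G t (\<pi> x) \<xi> v x)"

definition S_star ::
  "('x::polish_space, 'a::polish_space) score \<Rightarrow> nat \<Rightarrow> 'x measure \<Rightarrow> ('x \<Rightarrow> real) \<Rightarrow> 'x \<Rightarrow> real" where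
  "S_star G t \<xi> v = (\<lambda>x. INF l\<in>borel_probs. G t l \<xi> v x)"

definition S_comp ::
  "('x::polish_space, 'a::polish_space) score \<Rightarrow> (nat \<Rightarrow> 'x \<Rightarrow> 'a measure) \<Rightarrow> nat \<Rightarrow> nat \<Rightarrow> (nat \<Rightarrow> 'x measure) \<Rightarrow>
     ('x \<Rightarrow> real) \<Rightarrow> 'x \<Rightarrow> real" where
  "S_comp G \<pp> s t \<Xi> = foldr (\<lambda>r. S_op G r (\<pp> r) (\<Xi> r)) [s..<t]"

definition S_star_comp ::
  "('x::polish_space, 'a::polish_space) score \<Rightarrow> nat \<Rightarrow> nat \<Rightarrow> (nat \<Rightarrow> 'x measure) \<Rightarrow>
     ('x \<Rightarrow> real) \<Rightarrow> 'x \<Rightarrow> real" where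
  "S_star_comp G s t \<Xi> = foldr (\<lambda>r. S_star G r (\<Xi> r)) [s..<t]"

definition total_score ::
  "nat \<Rightarrow> (('x \<Rightarrow> real) \<Rightarrow> real) \<Rightarrow> ('x::polish_space, 'a::polish_space) score \<Rightarrow> (nat \<Rightarrow> 'x \<Rightarrow> 'a measure) \<Rightarrow>
     (nat \<Rightarrow> 'x measure) \<Rightarrow> ('x \<Rightarrow> real) \<Rightarrow> real" where
  "total_score T G0 G \<pp> \<Xi> = G0 \<circ> S_comp G \<pp> 1 T \<Xi>"

definition optimal_score ::
  "nat \<Rightarrow> (('x \<Rightarrow> real) \<Rightarrow> real) \<Rightarrow> ('x::polish_space, 'a::polish_space) score \<Rightarrow>
     (nat \<Rightarrow> 'x measure) \<Rightarrow> ('x \<Rightarrow> real) \<Rightarrow> real" where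
  "optimal_score T G0 G \<Xi> = G0 \<circ> S_star_comp G 1 T \<Xi>"

section \<open>Mean field flows\<close>

definition state_law :: "('x::polish_space \<times> 'a::polish_space) measure \<Rightarrow> 'x measure" where
  "state_law \<psi> = distr \<psi> borel fst"

definition induced_kernel ::
  "('x::polish_space \<times> 'a::polish_space) measure \<Rightarrow> ('x \<Rightarrow> 'a measure) \<Rightarrow> bool" where
  "induced_kernel \<psi> \<pi> \<longleftrightarrow> \<pi> \<in> action_kernels \<and>
     (\<forall>B\<in>sets borel. \<forall>A\<in>sets borel.
        emeasure \<psi> (B \<times> A) = (\<integral>\<^sup>+x\<in>B. emeasure (\<pi> x) A \<partial>state_law \<psi>))"

definition next_law ::
  "('x::polish_space, 'a::polish_space) transition \<Rightarrow> nat \<Rightarrow> ('x \<times> 'a) measure \<Rightarrow> 'x measure" where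
  "next_law P t \<psi> = \<psi> \<bind> (\<lambda>(y, a). P t y (state_law \<psi>) a)"

definition mean_field_flow ::
  "nat \<Rightarrow> ('x::polish_space, 'a::polish_space) transition \<Rightarrow> 'x measure \<Rightarrow> (nat \<Rightarrow> ('x \<times> 'a) measure) \<Rightarrow> bool" where
  "mean_field_flow T P \<xi>0 \<Psi> \<longleftrightarrow>
     (\<forall>t\<in>{1..T-1}. \<Psi> t \<in> borel_probs) \<and>
     state_law (\<Psi> 1) = \<xi>0 \<and>
     (\<forall>t\<in>{1..T-2}. \<forall>B\<in>sets borel.
        emeasure (state_law (\<Psi> (t + 1))) B =
          (\<integral>\<^sup>+(y, a). emeasure (P t y (state_law (\<Psi> t)) a) B \<partial>\<Psi> t))"

definition V_flow ::
  "nat \<Rightarrow> ('x::polish_space, 'a::polish_space) transition \<Rightarrow> (nat \<Rightarrow> ('x \<times> 'a) measure) \<Rightarrow>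
     ('x \<times> 'x measure \<Rightarrow> real) \<Rightarrow> 'x \<Rightarrow> real" where
  "V_flow T P \<Psi> V = (\<lambda>x. V (x, next_law P (T - 1) (\<Psi> (T - 1))))"

section \<open>Exploitabilities\<close>

text \<open>The induced action kernels are determined only up to null sets; the version \<open>\<pp>\<close> that is
  used is an explicit argument.\<close>

definition exploitability ::
  "nat \<Rightarrow> ('x::polish_space, 'a::polish_space) transition \<Rightarrow> (('x \<Rightarrow> real) \<Rightarrow> real) \<Rightarrow> ('x, 'a) score \<Rightarrow>
     (nat \<Rightarrow> 'x \<Rightarrow> 'a measure) \<Rightarrow> (nat \<Rightarrow> ('x \<times> 'a) measure) \<Rightarrow> ('x \<times> 'x measure \<Rightarrow> real) \<Rightarrow> real" where
  "exploitability T P G0 G \<pp> \<Psi> V =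
     total_score T G0 G \<pp> (\<lambda>t. state_law (\<Psi> t)) (V_flow T P \<Psi> V)
     - optimal_score T G0 G (\<lambda>t. state_law (\<Psi> t)) (V_flow T P \<Psi> V)"

definition stepwise_exploitability ::
  "real \<Rightarrow> nat \<Rightarrow> ('x::polish_space, 'a::polish_space) transition \<Rightarrow> ('x, 'a) score \<Rightarrow>
     (nat \<Rightarrow> 'x \<Rightarrow> 'a measure) \<Rightarrow> (nat \<Rightarrow> ('x \<times> 'a) measure) \<Rightarrow> ('x \<times> 'x measure \<Rightarrow> real) \<Rightarrow> real" where
  "stepwise_exploitability cbar T P G \<pp> \<Psi> V =
     (\<Sum>t=1..T-1. cbar ^ t *
        (\<integral>x. (S_op G t (\<pp> t) (state_law (\<Psi> t))
                 (S_star_comp G (t + 1) T (\<lambda>t. state_law (\<Psi> t)) (V_flow T P \<Psi> V)) x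
               - S_star_comp G t T (\<lambda>t. state_law (\<Psi> t)) (V_flow T P \<Psi> V) x)
           \<partial>state_law (\<Psi> t)))"

section \<open>Assumptions\<close>

definition monotonicity ::
  "nat \<Rightarrow> (('x \<Rightarrow> real) \<Rightarrow> real) \<Rightarrow> ('x::polish_space, 'a::polish_space) score \<Rightarrow> bool" where
  "monotonicity T G0 G \<longleftrightarrow>
     (\<forall>v\<in>bdd_borel borel. \<forall>v'\<in>bdd_borel borel. v \<le> v' \<longrightarrow>
        G0 v \<le> G0 v' \<and>
        (\<forall>t\<in>{1..T-1}. \<forall>l\<in>borel_probs. \<forall>\<xi>\<in>borel_probs. G t l \<xi> v \<le> G t l \<xi> v'))"

definition growth_bound ::
  "nat \<Rightarrow> ('x::polish_space, 'a::polish_space) score \<Rightarrow> real \<Rightarrow> real \<Rightarrow> bool" where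
  "growth_bound T G c0 c1 \<longleftrightarrow> c0 > 0 \<and> c1 > 0 \<and>
     (\<forall>t\<in>{1..T-1}. \<forall>l\<in>borel_probs. \<forall>\<xi>\<in>borel_probs. \<forall>v\<in>bdd_borel borel.
        sup_norm (G t l \<xi> v) \<le> c0 + c1 * sup_norm v)"

definition score_continuity ::
  "nat \<Rightarrow> ('x::polish_space, 'a::polish_space) score \<Rightarrow> real \<Rightarrow> real \<Rightarrow> bool" where
  "score_continuity T G c0 c1 \<longleftrightarrow>
     (\<exists>\<zeta>. subadditive_modulus \<zeta> \<and>
       (\<forall>t\<in>{1..T-1}. \<forall>l\<in>borel_probs. \<forall>l'\<in>borel_probs. \<forall>\<xi>\<in>borel_probs. \<forall>\<xi>'\<in>borel_probs.
        \<forall>v\<in>bdd_borel borel.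
          ennreal (sup_norm (\<lambda>x. G t l \<xi> v x - G t l' \<xi>' v x))
          \<le> ennreal (c0 + c1 * sup_norm v) *
              (\<zeta> (ennreal (bl_dist \<xi> \<xi>')) + \<zeta> (ennreal (bl_dist l l')))))"

definition integral_bound ::
  "nat \<Rightarrow> ('x::polish_space, 'a::polish_space) transition \<Rightarrow> 'x measure \<Rightarrow> (('x \<Rightarrow> real) \<Rightarrow> real) \<Rightarrow>
     ('x, 'a) score \<Rightarrow> real \<Rightarrow> bool" where
  "integral_bound T P \<xi>0 G0 G cbar \<longleftrightarrow> cbar > 0 \<and>
     (\<forall>v\<in>bdd_borel borel. \<forall>v'\<in>bdd_borel borel.
        \<bar>G0 v - G0 v'\<bar> \<le> cbar * (\<integral>y. \<bar>v y - v' y\<bar> \<partial>\<xi>0) \<and>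
        (\<forall>t\<in>{1..T-1}. \<forall>l\<in>borel_probs. \<forall>\<xi>\<in>borel_probs. \<forall>x.
           \<bar>G t l \<xi> v x - G t l \<xi> v' x\<bar> \<le> cbar * (\<integral>y. \<bar>v y - v' y\<bar> \<partial>Q_kernel P t l x \<xi>)))"

definition integral_lower_bound ::
  "nat \<Rightarrow> ('x::polish_space, 'a::polish_space) transition \<Rightarrow> 'x measure \<Rightarrow> (('x \<Rightarrow> real) \<Rightarrow> real) \<Rightarrow>
     ('x, 'a) score \<Rightarrow> real \<Rightarrow> bool" where
  "integral_lower_bound T P \<xi>0 G0 G cund \<longleftrightarrow> cund > 0 \<and>
     (\<forall>v\<in>bdd_borel borel. \<forall>v'\<in>bdd_borel borel. v' \<le> v \<longrightarrow>
        G0 v - G0 v' \<ge> cund * (\<integral>y. (v y - v' y) \<partial>\<xi>0) \<and>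
        (\<forall>t\<in>{1..T-1}. \<forall>l\<in>borel_probs. \<forall>\<xi>\<in>borel_probs. \<forall>x.
           G t l \<xi> v x - G t l \<xi> v' x \<ge> cund * (\<integral>y. (v y - v' y) \<partial>Q_kernel P t l x \<xi>)))"

end

theory Submission
  imports Defs
begin

text \<open>
  Both exploitabilities compare the values of the given policy with the optimal values. Write \<open>D t\<close> for
  the difference of the two value functions at time \<open>t\<close>, averaged over the population law \<open>\<xi> t\<close>, and \<open>e t\<close>
  for the averaged loss of one period of the policy followed by optimal play. Then
  \<open>D t\<close> is \<open>e t\<close> plus the averaged difference of a single score operator at the two continuation values.
  The integral bound estimates that difference by \<open>cbar\<close> times an integral against the mixed transition
  kernel, and the average of this kernel over \<open>\<xi> t\<close> is \<open>\<xi> (t + 1)\<close>: this is where it matters that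
  \<open>\<Psi>\<close> is a mean field flow (\<open>next_population\<close>). So
  \<open>D t \<le> cbar * D (t + 1) + e t\<close>, where \<open>D T = 0\<close>; the same bound for the initial operator estimates the
  exploitability by \<open>cbar * D 1\<close>, and unrolling the recursion
  (\<open>telescoped_upper_bound\<close>) produces the weighted sum of the \<open>e t\<close>. The lower integral bound gives the
  reverse recursion with \<open>cund\<close>; the weights are then compared using \<open>cund \<le> cbar\<close> and \<open>e t \<ge> 0\<close>.

  For the integrals to behave, the optimal value functions must be Borel, although they are infima over
  possibly uncountably many randomized actions. The probability measures on a compact space are totally bounded
  in the bounded Lipschitz norm (\<open>bl_dist_finite_net\<close>), and the score is continuous in the action for
  that norm, so the infimum may be taken over a countable set (\<open>S_star_bdd_borel\<close>). Kernels are measurable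
  for the Borel sets of the weak topology; \<open>borel_weak_into_prob_algebra\<close> makes them
  kernels of the Giry monad, in which they are composed and disintegrated.
\<close>

section \<open>Measures as points of the weak Borel space\<close>

lemma space_borel_weak [simp]: "space (borel_weak :: 'y::polish_space measure measure) = borel_probs"
  unfolding borel_weak_def by (rule space_measure_of_conv)

lemma integral_borel_measurable_weak:
  fixes f :: "'y::polish_space \<Rightarrow> real"
  assumes "continuous_on UNIV f" "bounded (range f)"
  shows "(\<lambda>\<mu>. \<integral>y. f y \<partial>\<mu>) \<in> borel_measurable borel_weak"
proof (rule borel_measurableI)
  fix U :: "real set" assume "open U"
  let ?W = "{\<mu> \<in> (borel_probs :: 'y measure set). (\<integral>y. f y \<partial>\<mu>) \<in> U}"
  have "openin weak_topology ?W"
    unfolding weak_topology_def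
    by (rule topology_generated_by_Basis) (use assms \<open>open U\<close> in blast)
  moreover have "{U. openin weak_topology U} \<subseteq> Pow (borel_probs :: 'y measure set)"
    using openin_subset[of weak_topology] by (auto simp: topspace_weak_topology)
  ultimately have "?W \<in> sets borel_weak"
    unfolding borel_weak_def by (auto simp: sets_measure_of)
  then show "(\<lambda>\<mu>. \<integral>y. f y \<partial>\<mu>) -` U \<inter> space borel_weak \<in> sets borel_weak"
    by (simp add: vimage_def Int_def conj_commute)
qed

text \<open>The indicator of a proper open subset is the increasing limit of the bounded continuous functions
  \<open>min 1 (n d(y, -U))\<close>, so evaluation at \<open>U\<close> is a limit of weakly continuous functions. This is
  what links the weak topology, in which kernels are given, to the Giry monad, in which
  they are composed.\<close>

lemma measure_open_borel_measurable_weak: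
  fixes U :: "'y::polish_space set"
  assumes "open U"
  shows "(\<lambda>\<mu>. measure \<mu> U) \<in> borel_measurable borel_weak"
proof (cases "U = UNIV")
  case True
  have "measure \<mu> UNIV = 1" if "\<mu> \<in> borel_probs" for \<mu> :: "'y measure"
    using that prob_space.prob_space[of \<mu>] sets_eq_imp_space_eq[of \<mu> borel]
    by (auto simp: borel_probs_eq)
  then show ?thesis
    unfolding True by (subst measurable_cong[where g="\<lambda>_. 1"]) auto
next
  case False
  define f where "f n y = min 1 (real n * infdist y (- U))" for n y
  have cont: "continuous_on UNIV (f n)" for n
    unfolding f_def by (intro continuous_intros)
  have bounds: "\<bar>f n y\<bar> \<le> 1" for n y
    by (simp add: f_def infdist_nonneg)
  have meas: "f n \<in> borel_measurable borel" for n
    by (rule borel_measurable_continuous_onI[OF cont])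
  have lim: "(\<lambda>n. f n y) \<longlonglongrightarrow> indicator U y" for y
  proof (cases "y \<in> U")
    case True
    have pos: "infdist y (- U) > 0"
      using False True assms by (intro infdist_pos_not_in_closed) (auto simp: closed_Compl)
    obtain N :: nat where N: "1 / infdist y (- U) \<le> real N"
      using real_arch_simple by blast
    have "f n y = 1" if "n \<ge> N" for n
    proof -
      have "1 / infdist y (- U) \<le> real n" using N that by linarith
      then show ?thesis using pos by (simp add: f_def field_simps)
    qed
    then have "eventually (\<lambda>n. f n y = indicator U y) sequentially"
      using True by (auto simp: eventually_sequentially)
    then show ?thesis by (rule tendsto_eventually)
  next
    case False
    then show ?thesis by (simp add: f_def)
  qed
  have conv: "(\<lambda>n. \<integral>y. f n y \<partial>\<mu>) \<longlonglongrightarrow> measure \<mu> U" if \<mu>: "\<mu> \<in> borel_probs" for \<mu> :: "'y measure"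
  proof -
    interpret prob_space \<mu> using \<mu> by (simp add: borel_probs_eq)
    have [measurable_cong]: "sets \<mu> = sets borel" using \<mu> by (simp add: borel_probs_eq)
    note meas[measurable]
    have [measurable]: "U \<in> sets borel" using assms by simp
    have "(\<lambda>n. \<integral>y. f n y \<partial>\<mu>) \<longlonglongrightarrow> (\<integral>y. indicator U y \<partial>\<mu>)"
      by (rule integral_dominated_convergence[where w="\<lambda>_. 1"]) (use lim bounds in auto)
    then show ?thesis
      using sets_eq_imp_space_eq[OF \<open>sets \<mu> = sets borel\<close>] by simp
  qed
  have "(\<lambda>\<mu>. \<integral>y. f n y \<partial>\<mu>) \<in> borel_measurable borel_weak" for n
    by (intro integral_borel_measurable_weak cont boundedI[where B=1]) (use bounds in auto)
  then show ?thesis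
    by (rule borel_measurable_LIMSEQ_real[where u="\<lambda>n \<mu>. \<integral>y. f n y \<partial>\<mu>", rotated]) (simp add: conv)
qed

lemma borel_weak_into_prob_algebra:
  "(\<lambda>\<mu>. \<mu>) \<in> borel_weak \<rightarrow>\<^sub>M prob_algebra (borel :: 'y::polish_space measure)"
proof (rule measurable_prob_algebra_generated[where \<Omega>=UNIV and G="{U. open U}"])
  show "sets borel = sigma_sets UNIV {U::'y set. open U}"
    by (simp add: sets_borel)
  show "Int_stable {U::'y set. open U}"
    by (auto simp: Int_stable_def)
  fix U :: "'y set" assume "U \<in> {U. open U}"
  then have "(\<lambda>\<mu>. ennreal (measure \<mu> U)) \<in> borel_measurable borel_weak"
    using measure_open_borel_measurable_weak[of U] by simp
  moreover have "emeasure \<mu> U = ennreal (measure \<mu> U)" if "\<mu> \<in> borel_probs" for \<mu> :: "'y measure"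
  proof -
    interpret prob_space \<mu> using that by (simp add: borel_probs_eq)
    show ?thesis by (rule emeasure_eq_measure)
  qed
  ultimately show "(\<lambda>\<mu>. emeasure \<mu> U) \<in> borel_measurable borel_weak"
    by (subst measurable_cong[where g="\<lambda>\<mu>. ennreal (measure \<mu> U)"]) auto
qed (auto simp: borel_probs_eq)

lemmas measurable_weak_imp_prob_algebra =
  measurable_compose[OF _ borel_weak_into_prob_algebra]

section \<open>Total boundedness of the probability measures on a compact space\<close>

text \<open>Cut the space into finitely many Borel cells of diameter of order \<open>\<epsilon>\<close>. Up to \<open>\<epsilon>\<close>, a 1-Lipschitz
  test function only sees the masses of the cells, so measures whose cell masses agree after
  rounding to a fine grid are close. There are finitely many rounded mass vectors; one
  measure is kept for each vector that occurs.\<close>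

lemma bl_dist_finite_net:
  fixes \<epsilon> :: real
  assumes "compact (UNIV :: 'a::polish_space set)" "\<epsilon> > 0"
  shows "\<exists>D \<subseteq> (borel_probs :: 'a measure set). finite D \<and> (\<forall>l\<in>borel_probs. \<exists>l'\<in>D. bl_dist l l' \<le> \<epsilon>)"
proof -
  define \<delta> where "\<delta> = \<epsilon> / 2"
  have "\<delta> > 0" using assms by (simp add: \<delta>_def)
  obtain k :: "'a set" where k: "finite k" "UNIV \<subseteq> (\<Union>x\<in>k. ball x \<delta>)"
    using assms(1) \<open>\<delta> > 0\<close> unfolding compact_eq_totally_bounded by meson
  obtain n :: nat and f :: "nat \<Rightarrow> 'a" where f: "k = f ` {i. i < n}"
    using finite_imp_nat_seg_image_inj_on[OF k(1)] by auto
  define I where "I y = (LEAST i. dist (f i) y < \<delta>)" for y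
  have ex: "\<exists>i<n. dist (f i) y < \<delta>" for y
    using k(2) unfolding f by (force simp: subset_eq)
  have I_dist: "dist (f (I y)) y < \<delta>" for y
    unfolding I_def by (rule LeastI_ex) (use ex[of y] in blast)
  have I_less: "I y < n" for y
    unfolding I_def using ex[of y] by (meson Least_le le_less_trans)
  have I_meas [measurable]: "I \<in> borel \<rightarrow>\<^sub>M count_space UNIV"
    unfolding I_def by measurable
  define cell where "cell i = {y. I y = i}" for i
  have cell [measurable]: "cell i \<in> sets borel" for i
    using measurable_sets[OF I_meas, of "{i}"] by (simp add: cell_def vimage_def)

  have approx: "\<bar>(\<integral>y. h y \<partial>l) - (\<Sum>i<n. h (f i) * measure l (cell i))\<bar> \<le> \<delta>"
    if h: "1-lipschitz_on UNIV h" "range h \<subseteq> {-1..1}" and l: "l \<in> borel_probs"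
    for h :: "'a \<Rightarrow> real" and l
  proof -
    interpret prob_space l using l by (simp add: borel_probs_eq)
    have sets_l [measurable_cong]: "sets l = sets borel" using l by (simp add: borel_probs_eq)
    have space_l: "space l = UNIV" using sets_eq_imp_space_eq[OF sets_l] by simp
    have [measurable]: "h \<in> borel_measurable borel"
      using lipschitz_on_continuous_on[OF h(1)] by (rule borel_measurable_continuous_onI)
    have h_bd: "\<bar>h y\<bar> \<le> 1" for y using h(2) by (auto simp: subset_eq abs_le_iff)
    have int_h: "integrable l h"
      by (rule integrable_const_bound[where B=1]) (use h_bd in auto)
    have step: "h (f (I y)) = (\<Sum>i<n. h (f i) * indicator (cell i) y)" for y
    proof -
      have "(\<Sum>i<n. h (f i) * indicator (cell i) y) = (\<Sum>i\<in>{I y}. h (f i) * indicator (cell i) y)"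
        by (rule sum.mono_neutral_right) (use I_less in \<open>auto simp: cell_def\<close>)
      then show ?thesis by (simp add: cell_def)
    qed
    have int_step: "integrable l (\<lambda>y. h (f (I y)))"
      unfolding step by (intro Bochner_Integration.integrable_sum integrable_mult_right integrable_real_indicator)
        (auto simp: emeasure_eq_measure)
    have "(\<integral>y. h (f (I y)) \<partial>l) = (\<Sum>i<n. h (f i) * measure l (cell i))"
      unfolding step by (subst Bochner_Integration.integral_sum)
        (auto simp: emeasure_eq_measure space_l intro!: integrable_mult_right integrable_real_indicator)
    then have "\<bar>(\<integral>y. h y \<partial>l) - (\<Sum>i<n. h (f i) * measure l (cell i))\<bar> = \<bar>\<integral>y. (h y - h (f (I y))) \<partial>l\<bar>"
      using int_h int_step by simp
    also have "\<dots> \<le> (\<integral>y. \<bar>h y - h (f (I y))\<bar> \<partial>l)"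
      using integral_norm_bound[of l "\<lambda>y. h y - h (f (I y))"] by simp
    also have "\<dots> \<le> (\<integral>y. \<delta> \<partial>l)"
    proof (rule integral_mono)
      show "integrable l (\<lambda>y. \<bar>h y - h (f (I y))\<bar>)" using int_h int_step by simp
      show "\<bar>h y - h (f (I y))\<bar> \<le> \<delta>" for y
        using lipschitz_onD[OF h(1), of y "f (I y)"] I_dist[of y]
        by (simp add: dist_real_def dist_commute)
    qed simp
    finally show ?thesis by (simp add: prob_space)
  qed

  \<comment> \<open>Rounding each of the \<open>n\<close> masses to a multiple of \<open>1/M\<close> costs at most \<open>n/M \<le> \<epsilon>\<close> in total; with the
    discretization error \<open>\<delta> = \<epsilon>/2\<close> of each of the two measures this is \<open>2\<epsilon>\<close>, which the factor \<open>1/2\<close>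
    in the norm turns into \<open>\<epsilon>\<close>.\<close>
  obtain M :: nat where M: "real n / \<epsilon> < real M" using reals_Archimedean2 by blast
  have "real M > 0" using M assms(2) by (smt (verit) divide_nonneg_pos of_nat_0_le_iff)
  define code where "code l = (\<lambda>i\<in>{..<n}. nat \<lfloor>real M * measure l (cell i)\<rfloor>)" for l :: "'a measure"
  have "code l \<in> PiE {..<n} (\<lambda>_. {..M})" if l: "l \<in> borel_probs" for l
  proof -
    interpret prob_space l using l by (simp add: borel_probs_eq)
    have "real M * measure l (cell i) < real M + 1" for i
    proof -
      have "real M * measure l (cell i) \<le> real M * 1" by (intro mult_left_mono) auto
      then show ?thesis by linarith
    qed
    then show ?thesis unfolding code_def
      by (auto simp: nat_le_iff floor_le_iff)
  qed
  then have fin: "finite (code ` borel_probs)"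
    by (meson finite_PiE finite_atMost finite_lessThan finite_subset image_subsetI)
  define D where "D = inv_into borel_probs code ` (code ` borel_probs)"
  have D: "D \<subseteq> borel_probs" unfolding D_def by (auto intro!: inv_into_into)
  have close: "bl_dist l l' \<le> \<epsilon>" if l: "l \<in> borel_probs" and l': "l' \<in> borel_probs" and eq: "code l = code l'"
    for l l' :: "'a measure"
  proof -
    have masses: "\<bar>measure l (cell i) - measure l' (cell i)\<bar> \<le> 1 / real M" if "i < n" for i
    proof -
      have "nat \<lfloor>real M * measure l (cell i)\<rfloor> = nat \<lfloor>real M * measure l' (cell i)\<rfloor>"
        using fun_cong[OF eq, of i] that by (simp add: code_def)
      moreover have "\<lfloor>real M * measure l (cell i)\<rfloor> \<ge> 0" "\<lfloor>real M * measure l' (cell i)\<rfloor> \<ge> 0"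
        by simp_all
      ultimately have "\<lfloor>real M * measure l (cell i)\<rfloor> = \<lfloor>real M * measure l' (cell i)\<rfloor>"
        by linarith
      then have "\<bar>real M * measure l (cell i) - real M * measure l' (cell i)\<bar> \<le> 1"
        by linarith
      then have "real M * \<bar>measure l (cell i) - measure l' (cell i)\<bar> \<le> 1"
        by (metis abs_mult abs_of_nat right_diff_distrib)
      then show ?thesis using \<open>real M > 0\<close> by (simp add: field_simps)
    qed
    show ?thesis unfolding bl_dist_def
    proof (rule cSUP_least)
      show "{h :: 'a \<Rightarrow> real. 1-lipschitz_on UNIV h \<and> range h \<subseteq> {-1..1}} \<noteq> {}"
        by (auto intro!: exI[of _ "\<lambda>_. 0"] lipschitz_onI)
      fix h :: "'a \<Rightarrow> real" assume "h \<in> {h. 1-lipschitz_on UNIV h \<and> range h \<subseteq> {-1..1}}"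
      then have h: "1-lipschitz_on UNIV h" "range h \<subseteq> {-1..1}" by auto
      have h_bd: "\<bar>h y\<bar> \<le> 1" for y using h(2) by (auto simp: subset_eq abs_le_iff)
      have "(\<Sum>i<n. h (f i) * measure l (cell i)) - (\<Sum>i<n. h (f i) * measure l' (cell i))
          = (\<Sum>i<n. h (f i) * (measure l (cell i) - measure l' (cell i)))"
        by (simp add: sum_subtractf right_diff_distrib)
      also have "\<dots> \<le> (\<Sum>i<n. 1 / real M)"
      proof (rule sum_mono)
        fix i assume "i \<in> {..<n}"
        have "h (f i) * (measure l (cell i) - measure l' (cell i))
            \<le> \<bar>h (f i)\<bar> * \<bar>measure l (cell i) - measure l' (cell i)\<bar>"
          by (metis abs_ge_self abs_mult)
        also have "\<dots> \<le> 1 * (1 / real M)"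
          by (intro mult_mono) (use h_bd masses \<open>i \<in> {..<n}\<close> in auto)
        finally show "h (f i) * (measure l (cell i) - measure l' (cell i)) \<le> 1 / real M" by simp
      qed
      also have "\<dots> \<le> \<epsilon>"
        using M \<open>real M > 0\<close> assms(2) by (simp add: field_simps)
      finally have "(\<integral>y. h y \<partial>l) - (\<integral>y. h y \<partial>l') \<le> \<epsilon> + 2 * \<delta>"
        using approx[OF h l] approx[OF h l'] by linarith
      then show "((\<integral>y. h y \<partial>l) - (\<integral>y. h y \<partial>l')) / 2 \<le> \<epsilon>" by (simp add: \<delta>_def)
    qed
  qed
  have "\<exists>l'\<in>D. bl_dist l l' \<le> \<epsilon>" if l: "l \<in> borel_probs" for l :: "'a measure"
  proof
    show "inv_into borel_probs code (code l) \<in> D" using l by (auto simp: D_def)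
    then show "bl_dist l (inv_into borel_probs code (code l)) \<le> \<epsilon>"
      using D l by (intro close) (auto simp: f_inv_into_f)
  qed
  then show ?thesis using D fin by (intro exI[of _ D]) (auto simp: D_def)
qed

lemma bl_dist_countable_dense:
  assumes "compact (UNIV :: 'a::polish_space set)"
  obtains D :: "'a::polish_space measure set"
  where "countable D" "D \<subseteq> borel_probs" "\<And>l \<epsilon>. l \<in> borel_probs \<Longrightarrow> \<epsilon> > 0 \<Longrightarrow> \<exists>l'\<in>D. bl_dist l l' \<le> \<epsilon>"
proof -
  have "\<forall>n. \<exists>D \<subseteq> (borel_probs :: 'a measure set). finite D \<and>
      (\<forall>l\<in>borel_probs. \<exists>l'\<in>D. bl_dist l l' \<le> inverse (real (Suc n)))"
    using bl_dist_finite_net[OF assms] by simp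
  then obtain D where D: "\<And>n. D n \<subseteq> (borel_probs :: 'a measure set)" "\<And>n. finite (D n)"
    "\<And>n l. l \<in> borel_probs \<Longrightarrow> \<exists>l'\<in>D n. bl_dist l l' \<le> inverse (real (Suc n))"
    by metis
  show ?thesis
  proof (rule that[of "\<Union>n. D n"])
    show "countable (\<Union>n. D n)" using D(2) by (auto intro: countable_finite)
    show "(\<Union>n. D n) \<subseteq> borel_probs" using D(1) by auto
    fix l :: "'a measure" and \<epsilon> :: real assume "l \<in> borel_probs" "\<epsilon> > 0"
    obtain n where "inverse (real (Suc n)) < \<epsilon>" using reals_Archimedean[OF \<open>\<epsilon> > 0\<close>] by auto
    then show "\<exists>l'\<in>\<Union>n. D n. bl_dist l l' \<le> \<epsilon>"
      using D(3)[OF \<open>l \<in> borel_probs\<close>, of n] by force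
  qed
qed

section \<open>Disintegration of a mean field flow\<close>

lemma sets_borel_probs_pair:
  assumes "\<psi> \<in> (borel_probs :: ('x::polish_space \<times> 'a::polish_space) measure set)"
  shows "sets \<psi> = sets (borel \<Otimes>\<^sub>M borel)"
  using assms unfolding borel_prod borel_probs_eq by simp

lemma state_law_borel_probs:
  assumes "\<psi> \<in> (borel_probs :: ('x::polish_space \<times> 'a::polish_space) measure set)"
  shows "state_law \<psi> \<in> borel_probs"
proof -
  have [measurable_cong]: "sets \<psi> = sets (borel \<Otimes>\<^sub>M borel)" 
    using assms by (rule sets_borel_probs_pair)
  show ?thesis using assms unfolding state_law_def borel_probs_eq
    by (auto intro!: prob_space.prob_space_distr)
qed

text \<open>Both sides agree on rectangles, which determine \<open>\<psi>\<close>; integrating a kernel against the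
  disintegrated \<open>\<psi>\<close> is then associativity of the Giry bind.\<close>

lemma bind_disintegration:
  fixes \<psi> :: "('x::polish_space \<times> 'a::polish_space) measure"
  assumes \<psi>: "\<psi> \<in> borel_probs" and ind: "induced_kernel \<psi> \<pi>"
    and K [measurable]: "(\<lambda>(x, a). K x a) \<in> borel \<Otimes>\<^sub>M borel \<rightarrow>\<^sub>M prob_algebra N"
  shows "\<psi> \<bind> (\<lambda>(x, a). K x a) = state_law \<psi> \<bind> (\<lambda>x. \<pi> x \<bind> K x)"
proof -
  have \<pi> [measurable]: "\<pi> \<in> borel \<rightarrow>\<^sub>M prob_algebra borel"
    using ind unfolding induced_kernel_def action_kernels_def
    by (auto intro: measurable_weak_imp_prob_algebra)
  have sets_\<psi>: "sets \<psi> = sets (borel \<Otimes>\<^sub>M borel)"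
    using \<psi> by (rule sets_borel_probs_pair)
  have \<psi>': "prob_space \<psi>" using \<psi> by (simp add: borel_probs_eq)
  have \<xi>: "state_law \<psi> \<in> borel_probs" using \<psi> by (rule state_law_borel_probs)
  then have sets_\<xi> [measurable_cong]: "sets (state_law \<psi>) = sets borel"
    by (simp add: borel_probs_eq)
  have ne: "space (state_law \<psi>) \<noteq> {}"
    using sets_eq_imp_space_eq[OF sets_\<xi>] by simp
  have sets_\<pi>: "sets (\<pi> x) = sets borel" and prob_\<pi>: "prob_space (\<pi> x)" for x
    using measurable_space[OF \<pi>, of x] by (auto simp: borel_probs_eq)
  \<comment> \<open>The kernel \<open>\<delta>\<^sub>x \<otimes> \<pi>(x)\<close>; its mixture over the state law is \<open>\<psi>\<close>.\<close>
  define J where "J x = distr (\<pi> x) (borel \<Otimes>\<^sub>M borel) (Pair x)" for x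
  have J [measurable]: "J \<in> borel \<rightarrow>\<^sub>M prob_algebra (borel \<Otimes>\<^sub>M borel)"
    unfolding J_def by measurable
  have JS: "J \<in> state_law \<psi> \<rightarrow>\<^sub>M subprob_algebra (borel \<Otimes>\<^sub>M borel)"
    using measurable_prob_algebraD[OF J] by simp
  have "\<psi> = state_law \<psi> \<bind> J"
  proof (rule measure_eqI_generator_eq_countable[OF Int_stable_pair_measure_generator[of borel borel]])
    show "{a \<times> b |a b. a \<in> sets (borel :: 'x measure) \<and> b \<in> sets (borel :: 'a measure)} \<subseteq> Pow UNIV" by simp
    fix X assume "X \<in> {a \<times> b |a b. a \<in> sets (borel :: 'x measure) \<and> b \<in> sets (borel :: 'a measure)}"
    then obtain B A where X: "X = B \<times> A" and B: "B \<in> sets borel" and A: "A \<in> sets borel" by auto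
    have "emeasure (state_law \<psi> \<bind> J) X = (\<integral>\<^sup>+x. emeasure (J x) X \<partial>state_law \<psi>)"
      by (rule emeasure_bind[OF ne JS]) (use A B X in auto)
    also have "\<dots> = (\<integral>\<^sup>+x\<in>B. emeasure (\<pi> x) A \<partial>state_law \<psi>)"
    proof (rule nn_integral_cong)
      fix x
      have "emeasure (J x) X = emeasure (\<pi> x) (Pair x -` X \<inter> space (\<pi> x))"
        unfolding J_def
        by (rule emeasure_distr) (use A B X sets_\<pi> in \<open>auto cong: measurable_cong_sets\<close>)
      also have "Pair x -` X \<inter> space (\<pi> x) = (if x \<in> B then A else {})"
        using sets_eq_imp_space_eq[OF sets_\<pi>[of x]] by (auto simp: X)
      finally show "emeasure (J x) X = emeasure (\<pi> x) A * indicator B x" by simp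
    qed
    also have "\<dots> = emeasure \<psi> X"
      using ind A B unfolding induced_kernel_def X by simp
    finally show "emeasure \<psi> X = emeasure (state_law \<psi> \<bind> J) X" ..
  next
    show "sets \<psi> = sigma_sets UNIV {a \<times> b |a b. a \<in> sets (borel :: 'x measure) \<and> b \<in> sets (borel :: 'a measure)}"
      unfolding sets_\<psi> sets_pair_measure by simp
    have "sets (state_law \<psi> \<bind> J) = sets (borel \<Otimes>\<^sub>M borel)"
      by (rule sets_bind_measurable[OF JS ne])
    then show "sets (state_law \<psi> \<bind> J) = sigma_sets UNIV {a \<times> b |a b. a \<in> sets (borel :: 'x measure) \<and> b \<in> sets (borel :: 'a measure)}"
      unfolding sets_pair_measure by simp
    show "{UNIV} \<subseteq> {a \<times> b |a b. a \<in> sets (borel :: 'x measure) \<and> b \<in> sets (borel :: 'a measure)}"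
      by (auto intro!: exI[of _ UNIV])
    show "emeasure \<psi> a \<noteq> \<infinity>" if "a \<in> {UNIV}" for a
      using prob_space.emeasure_space_1[OF \<psi>'] sets_eq_imp_space_eq[OF sets_\<psi>] that
      by (simp add: space_pair_measure)
  qed auto
  moreover have "J x \<bind> (\<lambda>(x, a). K x a) = \<pi> x \<bind> K x" for x
  proof -
    have "J x \<bind> (\<lambda>(x, a). K x a) = \<pi> x \<bind> (\<lambda>a. (\<lambda>(x, a). K x a) (x, a))"
      unfolding J_def
      by (rule bind_distr[OF _ measurable_prob_algebraD[OF K]])
         (use sets_\<pi> prob_\<pi> prob_space.not_empty in \<open>auto cong: measurable_cong_sets\<close>)
    then show ?thesis by simp
  qed
  ultimately show ?thesis
    using bind_assoc[OF JS measurable_prob_algebraD[OF K]] by simp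
qed

section \<open>Bounded Borel functions\<close>

lemma bdd_borelI:
  fixes v :: "'x::topological_space \<Rightarrow> real"
  assumes "v \<in> borel_measurable borel" "\<And>x. \<bar>v x\<bar> \<le> B"
  shows "v \<in> bdd_borel borel"
  using assms by (auto simp: bdd_borel_def intro!: boundedI[where B=B])

lemma abs_le_sup_norm:
  assumes "v \<in> bdd_borel borel"
  shows "\<bar>v x\<bar> \<le> sup_norm v"
proof -
  obtain B where "\<And>x. \<bar>v x\<bar> \<le> B"
    using assms by (auto simp: bdd_borel_def bounded_iff)
  then show ?thesis
    unfolding sup_norm_def by (intro cSUP_upper bdd_aboveI2) auto
qed

lemma bdd_borel_diff:
  fixes v w :: "'x::topological_space \<Rightarrow> real"
  assumes "v \<in> bdd_borel borel" "w \<in> bdd_borel borel"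
  shows "(\<lambda>x. v x - w x) \<in> bdd_borel borel"
proof (rule bdd_borelI)
  show "(\<lambda>x. v x - w x) \<in> borel_measurable borel"
    using assms by (auto simp: bdd_borel_def)
  show "\<bar>v x - w x\<bar> \<le> sup_norm v + sup_norm w" for x
    using abs_le_sup_norm[OF assms(1), of x] abs_le_sup_norm[OF assms(2), of x] by linarith
qed

lemma integrable_bdd_borel:
  assumes "v \<in> bdd_borel borel" "\<mu> \<in> borel_probs"
  shows "integrable \<mu> v"
proof -
  interpret prob_space \<mu> using assms by (simp add: borel_probs_eq)
  have [measurable_cong]: "sets \<mu> = sets borel" using assms by (simp add: borel_probs_eq)
  have [measurable]: "v \<in> borel_measurable borel" using assms by (simp add: bdd_borel_def)
  show ?thesis
    by (rule integrable_const_bound[where B="sup_norm v"]) (use abs_le_sup_norm[OF assms(1)] in auto)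
qed

lemma return_borel_probs: "return borel x \<in> borel_probs"
  by (auto simp: borel_probs_eq intro: prob_space_return)

lemma bl_dist_self: "bl_dist \<mu> \<mu> = 0"
proof -
  have "{h :: 'a \<Rightarrow> real. 1-lipschitz_on UNIV h \<and> range h \<subseteq> {-1..1}} \<noteq> {}"
    by (auto intro!: exI[of _ "\<lambda>_. 0"] lipschitz_onI)
  then show ?thesis by (simp add: bl_dist_def)
qed

section \<open>Score operators on bounded Borel functions\<close>

locale score_model =
  fixes T :: nat and G :: "('x::polish_space, 'a::polish_space) score" and c0 c1 :: real
  assumes scores: "score_operators T G"
    and compact_actions: "compact (UNIV :: 'a set)"
    and growth: "growth_bound T G c0 c1"
    and continuity: "score_continuity T G c0 c1"
begin

lemma score_bdd_borel:
  assumes "t \<in> {1..T-1}" "l \<in> borel_probs" "\<xi> \<in> borel_probs" "v \<in> bdd_borel borel"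
  shows "G t l \<xi> v \<in> bdd_borel borel"
  using scores assms unfolding score_operators_def by blast

lemma abs_score_le:
  assumes "t \<in> {1..T-1}" "l \<in> borel_probs" "\<xi> \<in> borel_probs" "v \<in> bdd_borel borel"
  shows "\<bar>G t l \<xi> v x\<bar> \<le> c0 + c1 * sup_norm v"
proof -
  have "sup_norm (G t l \<xi> v) \<le> c0 + c1 * sup_norm v"
    using growth assms unfolding growth_bound_def by blast
  then show ?thesis
    using abs_le_sup_norm[OF score_bdd_borel[OF assms], of x] by linarith
qed

lemma S_op_bdd_borel:
  assumes t: "t \<in> {1..T-1}" and \<pi>: "\<pi> \<in> action_kernels" and \<xi>: "\<xi> \<in> borel_probs"
    and v: "v \<in> bdd_borel borel"
  shows "S_op G t \<pi> \<xi> v \<in> bdd_borel borel"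
proof (rule bdd_borelI)
  have [measurable]: "(\<lambda>(x, \<xi>, l). G t l \<xi> v x) \<in> borel_measurable (borel \<Otimes>\<^sub>M (borel_weak \<Otimes>\<^sub>M borel_weak))"
    using scores t v unfolding score_operators_def by blast
  have [measurable]: "\<pi> \<in> borel \<rightarrow>\<^sub>M borel_weak" using \<pi> by (simp add: action_kernels_def)
  have "\<xi> \<in> space borel_weak" using \<xi> by simp
  then have "(\<lambda>x. (\<lambda>(x, \<xi>, l). G t l \<xi> v x) (x, \<xi>, \<pi> x)) \<in> borel_measurable borel"
    by measurable
  then show "S_op G t \<pi> \<xi> v \<in> borel_measurable borel"
    by (simp add: S_op_def)
  have "\<pi> x \<in> borel_probs" for x
    using measurable_space[of \<pi> borel borel_weak x] \<pi> by (simp add: action_kernels_def)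
  then show "\<bar>S_op G t \<pi> \<xi> v x\<bar> \<le> c0 + c1 * sup_norm v" for x
    unfolding S_op_def using abs_score_le t \<xi> v by blast
qed

lemma score_bdd_below:
  assumes "t \<in> {1..T-1}" "\<xi> \<in> borel_probs" "v \<in> bdd_borel borel" "D \<subseteq> borel_probs"
  shows "bdd_below ((\<lambda>l. G t l \<xi> v x) ` D)"
proof (rule bdd_belowI2)
  fix l assume "l \<in> D"
  then show "- (c0 + c1 * sup_norm v) \<le> G t l \<xi> v x"
    using abs_score_le[of t l \<xi> v x] assms by auto
qed

lemma S_star_le_score:
  assumes "t \<in> {1..T-1}" "\<xi> \<in> borel_probs" "v \<in> bdd_borel borel" "l \<in> borel_probs"
  shows "S_star G t \<xi> v x \<le> G t l \<xi> v x"
  unfolding S_star_def by (intro cINF_lower score_bdd_below assms order_refl)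

lemma score_uniformly_continuous_in_action:
  assumes t: "t \<in> {1..T-1}" and \<xi>: "\<xi> \<in> borel_probs" and v: "v \<in> bdd_borel borel" and "\<epsilon> > 0"
  shows "\<exists>\<delta>>0. \<forall>l\<in>borel_probs. \<forall>l'\<in>borel_probs. bl_dist l l' \<le> \<delta> \<longrightarrow>
    (\<forall>x. \<bar>G t l \<xi> v x - G t l' \<xi> v x\<bar> \<le> \<epsilon>)"
proof -
  obtain \<zeta> where \<zeta>: "subadditive_modulus \<zeta>"
    and cont: "\<And>l l'. l \<in> borel_probs \<Longrightarrow> l' \<in> borel_probs \<Longrightarrow>
      ennreal (sup_norm (\<lambda>x. G t l \<xi> v x - G t l' \<xi> v x))
          \<le> ennreal (c0 + c1 * sup_norm v) *
              (\<zeta> (ennreal (bl_dist \<xi> \<xi>)) + \<zeta> (ennreal (bl_dist l l')))"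
    using continuity t \<xi> v unfolding score_continuity_def by blast
  define K where "K = c0 + c1 * sup_norm v"
  have "sup_norm v \<ge> 0" using abs_le_sup_norm[OF v, of undefined] by linarith
  then have "K > 0" using growth unfolding growth_bound_def K_def by (simp add: add_pos_nonneg)
  have "eventually (\<lambda>u. \<zeta> u < ennreal (\<epsilon> / (2 * K))) (at_right 0)"
    using \<zeta> \<open>K > 0\<close> \<open>\<epsilon> > 0\<close> unfolding subadditive_modulus_def
    by (intro order_tendstoD(2)[where y=0]) auto
  then obtain b :: ennreal where b: "b > 0" "\<And>u. 0 < u \<Longrightarrow> u < b \<Longrightarrow> \<zeta> u < ennreal (\<epsilon> / (2 * K))"
    using eventually_at_right[of "0::ennreal" 1] by auto
  obtain u where u: "0 < u" "u < b" using dense[OF b(1)] by blast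
  then obtain \<delta> where \<delta>: "\<delta> > 0" "u = ennreal \<delta>"
    by (cases u) (auto simp: less_top[symmetric])
  have mono: "\<zeta> r \<le> \<zeta> s" if "r \<le> s" for r s
    using \<zeta> that unfolding subadditive_modulus_def by (auto dest: monoD)
  \<comment> \<open>The limit at \<open>0+\<close> says nothing about \<open>\<zeta> 0\<close> by itself; monotonicity carries the bound down to \<open>0\<close>,
    the value at which the unchanged population law enters.\<close>
  have small: "\<zeta> (ennreal r) \<le> ennreal (\<epsilon> / (2 * K))" if "r \<le> \<delta>" for r
    using mono[of "ennreal r" u] b(2)[OF u] \<delta> that by (auto intro: ennreal_leI)
  have "\<bar>G t l \<xi> v x - G t l' \<xi> v x\<bar> \<le> \<epsilon>"
    if l: "l \<in> borel_probs" and l': "l' \<in> borel_probs" and "bl_dist l l' \<le> \<delta>" for l l' x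
  proof -
    have "ennreal (sup_norm (\<lambda>x. G t l \<xi> v x - G t l' \<xi> v x))
        \<le> ennreal K * (\<zeta> (ennreal (bl_dist \<xi> \<xi>)) + \<zeta> (ennreal (bl_dist l l')))"
      unfolding K_def by (rule cont[OF l l'])
    also have "\<dots> \<le> ennreal K * (ennreal (\<epsilon> / (2 * K)) + ennreal (\<epsilon> / (2 * K)))"
      by (intro mult_left_mono add_mono small) (use that(3) \<delta> in \<open>auto simp: bl_dist_self\<close>)
    also have "\<dots> = ennreal \<epsilon>"
      using \<open>K > 0\<close> \<open>\<epsilon> > 0\<close>
      by (subst ennreal_plus[symmetric], simp, simp, subst ennreal_mult[symmetric]) auto
    finally have "sup_norm (\<lambda>x. G t l \<xi> v x - G t l' \<xi> v x) \<le> \<epsilon>"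
      using \<open>\<epsilon> > 0\<close> by simp
    moreover have "(\<lambda>x. G t l \<xi> v x - G t l' \<xi> v x) \<in> bdd_borel borel"
      by (intro bdd_borel_diff score_bdd_borel t l l' \<xi> v)
    ultimately show ?thesis
      using abs_le_sup_norm[of "\<lambda>x. G t l \<xi> v x - G t l' \<xi> v x" x] by linarith
  qed
  then show ?thesis using \<delta> by blast
qed

text \<open>The infimum runs over a possibly uncountable set of randomized actions, so its measurability is
  not automatic. By continuity in the action it equals the infimum over a countable dense set.\<close>

lemma S_star_bdd_borel:
  assumes t: "t \<in> {1..T-1}" and \<xi>: "\<xi> \<in> borel_probs" and v: "v \<in> bdd_borel borel"
  shows "S_star G t \<xi> v \<in> bdd_borel borel"
proof (rule bdd_borelI)
  obtain D :: "'a measure set" where D: "countable D" "D \<subseteq> borel_probs"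
    and dense: "\<And>l \<epsilon>. l \<in> borel_probs \<Longrightarrow> \<epsilon> > 0 \<Longrightarrow> \<exists>l'\<in>D. bl_dist l l' \<le> \<epsilon>"
    using bl_dist_countable_dense[OF compact_actions] by metis
  have "D \<noteq> {}" using dense[OF return_borel_probs, of 1] by auto
  have "S_star G t \<xi> v x = (INF l\<in>D. G t l \<xi> v x)" for x
  proof (rule antisym)
    show "S_star G t \<xi> v x \<le> (INF l\<in>D. G t l \<xi> v x)"
      by (intro cINF_greatest \<open>D \<noteq> {}\<close> S_star_le_score t \<xi> v) (use D in auto)
    show "(INF l\<in>D. G t l \<xi> v x) \<le> S_star G t \<xi> v x"
      unfolding S_star_def
    proof (rule cINF_greatest)
      show "(borel_probs :: 'a measure set) \<noteq> {}" using return_borel_probs by blast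
      fix l :: "'a measure" assume l: "l \<in> borel_probs"
      show "(INF l\<in>D. G t l \<xi> v x) \<le> G t l \<xi> v x"
      proof (rule field_le_epsilon)
        fix \<epsilon> :: real assume "\<epsilon> > 0"
        obtain \<delta> where \<delta>: "\<delta> > 0" "\<forall>l\<in>borel_probs. \<forall>l'\<in>borel_probs. bl_dist l l' \<le> \<delta> \<longrightarrow>
            (\<forall>x. \<bar>G t l \<xi> v x - G t l' \<xi> v x\<bar> \<le> \<epsilon>)"
          using score_uniformly_continuous_in_action[OF t \<xi> v \<open>\<epsilon> > 0\<close>] by blast
        obtain l' where l': "l' \<in> D" "bl_dist l l' \<le> \<delta>" using dense[OF l \<delta>(1)] by blast
        have "(INF l\<in>D. G t l \<xi> v x) \<le> G t l' \<xi> v x"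
          by (rule cINF_lower[OF score_bdd_below[OF t \<xi> v D(2)] l'(1)])
        moreover have "\<bar>G t l \<xi> v x - G t l' \<xi> v x\<bar> \<le> \<epsilon>"
          using \<delta>(2) l l' D(2) by blast
        ultimately show "(INF l\<in>D. G t l \<xi> v x) \<le> G t l \<xi> v x + \<epsilon>" by linarith
      qed
    qed
  qed
  moreover have "(\<lambda>x. INF l\<in>D. G t l \<xi> v x) \<in> borel_measurable borel"
  proof (rule borel_measurable_cINF[OF D(1)])
    show "G t l \<xi> v \<in> borel_measurable borel" if "l \<in> D" for l
      using score_bdd_borel[OF t _ \<xi> v, of l] that D(2) by (auto simp: bdd_borel_def)
    show "bdd_below ((\<lambda>l. G t l \<xi> v x) ` D)" for x
      by (rule score_bdd_below[OF t \<xi> v D(2)])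
  qed
  ultimately show "S_star G t \<xi> v \<in> borel_measurable borel"
    by (subst measurable_cong[where g="\<lambda>x. INF l\<in>D. G t l \<xi> v x"]) auto
  show "\<bar>S_star G t \<xi> v x\<bar> \<le> c0 + c1 * sup_norm v" for x
  proof -
    have "- (c0 + c1 * sup_norm v) \<le> S_star G t \<xi> v x"
      unfolding S_star_def
    proof (rule cINF_greatest)
      show "(borel_probs :: 'a measure set) \<noteq> {}" using return_borel_probs by blast
      show "- (c0 + c1 * sup_norm v) \<le> G t l \<xi> v x" if "l \<in> borel_probs" for l
        using abs_score_le[OF t that \<xi> v, of x] by linarith
    qed
    moreover have "S_star G t \<xi> v x \<le> c0 + c1 * sup_norm v"
      using S_star_le_score[OF t \<xi> v return_borel_probs, of x undefined]
        abs_score_le[OF t return_borel_probs \<xi> v, of undefined x] by linarith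
    ultimately show ?thesis by linarith
  qed
qed

end

section \<open>Telescoping\<close>

text \<open>Unrolling the recursion from \<open>m\<close> to \<open>n\<close> picks up one factor \<open>c\<close> per step, whence the weights
  \<open>c\<^sup>t\<close> in the stepwise exploitability; the factor \<open>c\<^sup>m\<close> in front of \<open>D m\<close> will be supplied, for \<open>m = 1\<close>,
  by the initial score operator.\<close>

lemma telescoped_upper_bound:
  fixes c :: real
  assumes "c \<ge> 0" "m \<le> n" "D n \<le> e n" "\<And>t. m \<le> t \<Longrightarrow> t < n \<Longrightarrow> D t \<le> c * D (Suc t) + e t"
  shows "c ^ m * D m \<le> (\<Sum>t=m..n. c ^ t * e t)"
  using assms(2,4)
proof (induction m rule: inc_induct)
  case base
  then show ?case using assms(1,3) by (simp add: mult_left_mono)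
next
  case (step m)
  have "c ^ m * D m \<le> c ^ m * (c * D (Suc m) + e m)"
    using step.prems step.hyps assms(1) by (intro mult_left_mono) auto
  also have "\<dots> = c ^ m * e m + c ^ Suc m * D (Suc m)" by (simp add: algebra_simps)
  also have "c ^ Suc m * D (Suc m) \<le> (\<Sum>t=Suc m..n. c ^ t * e t)"
    using step.IH step.prems by simp
  finally show ?case using step.hyps by (simp add: sum.atLeast_Suc_atMost)
qed

lemma telescoped_lower_bound:
  fixes c :: real
  assumes "c \<ge> 0" "m \<le> n" "D n \<ge> e n" "\<And>t. m \<le> t \<Longrightarrow> t < n \<Longrightarrow> D t \<ge> c * D (Suc t) + e t"
  shows "c ^ m * D m \<ge> (\<Sum>t=m..n. c ^ t * e t)"
  using telescoped_upper_bound[of c m n "\<lambda>t. - D t" "\<lambda>t. - e t"] assms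
  by (fastforce simp: sum_negf)

section \<open>Value functions along a mean field flow\<close>

locale mean_field_problem = score_model T G c0 c1
  for T :: nat and G :: "('x::polish_space, 'a::polish_space) score" and c0 c1 :: real +
  fixes P :: "('x, 'a) transition" and \<xi>0 :: "'x measure" and G0 :: "('x \<Rightarrow> real) \<Rightarrow> real"
    and \<Psi> :: "nat \<Rightarrow> ('x \<times> 'a) measure" and \<pp> :: "nat \<Rightarrow> 'x \<Rightarrow> 'a measure"
    and V :: "'x \<times> 'x measure \<Rightarrow> real"
  assumes horizon: "T \<ge> 2"
    and transitions: "transition_kernels T P"
    and mono: "monotonicity T G0 G"
    and flow: "mean_field_flow T P \<xi>0 \<Psi>"
    and induced: "\<forall>t\<in>{1..T-1}. induced_kernel (\<Psi> t) (\<pp> t)"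
    and terminal: "V \<in> bdd_borel (borel \<Otimes>\<^sub>M borel_weak)"
begin

abbreviation \<xi> :: "nat \<Rightarrow> 'x measure" where
  "\<xi> t \<equiv> state_law (\<Psi> t)"

abbreviation policy_value :: "nat \<Rightarrow> 'x \<Rightarrow> real" where
  "policy_value t \<equiv> S_comp G \<pp> t T \<xi> (V_flow T P \<Psi> V)"

abbreviation optimal_value :: "nat \<Rightarrow> 'x \<Rightarrow> real" where
  "optimal_value t \<equiv> S_star_comp G t T \<xi> (V_flow T P \<Psi> V)"

text \<open>The population laws average the pointwise losses: \<open>value_gap t\<close> is the loss of the given policy
  over all remaining periods, \<open>step_regret t\<close> the loss from using it in period \<open>t\<close> alone and acting
  optimally afterwards.\<close>

definition value_gap :: "nat \<Rightarrow> real" where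
  "value_gap t = (\<integral>x. policy_value t x - optimal_value t x \<partial>\<xi> t)"

definition step_regret :: "nat \<Rightarrow> real" where
  "step_regret t = (\<integral>x. S_op G t (\<pp> t) (\<xi> t) (optimal_value (t + 1)) x - optimal_value t x \<partial>\<xi> t)"

lemma flow_borel_probs: "t \<in> {1..T-1} \<Longrightarrow> \<Psi> t \<in> borel_probs"
  using flow unfolding mean_field_flow_def by blast

lemma population_borel_probs: "t \<in> {1..T-1} \<Longrightarrow> \<xi> t \<in> borel_probs"
  using flow_borel_probs by (rule state_law_borel_probs)

lemma policy_action_kernel: "t \<in> {1..T-1} \<Longrightarrow> \<pp> t \<in> action_kernels"
  using induced unfolding induced_kernel_def by blast

lemma policy_borel_probs:
  assumes "t \<in> {1..T-1}"
  shows "\<pp> t x \<in> borel_probs"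
  using measurable_space[of "\<pp> t" borel borel_weak x] policy_action_kernel[OF assms]
  by (simp add: action_kernels_def)

lemma population_transition_measurable:
  assumes "t \<in> {1..T-1}"
  shows "(\<lambda>(x, a). P t x (\<xi> t) a) \<in> borel \<Otimes>\<^sub>M borel \<rightarrow>\<^sub>M prob_algebra borel"
proof -
  have [measurable]: "(\<lambda>(x, \<xi>, a). P t x \<xi> a) \<in> borel \<Otimes>\<^sub>M (borel_weak \<Otimes>\<^sub>M borel) \<rightarrow>\<^sub>M borel_weak"
    using transitions assms unfolding transition_kernels_def by blast
  have "\<xi> t \<in> space borel_weak" using population_borel_probs[OF assms] by simp
  then have "(\<lambda>z. (\<lambda>(x, \<xi>, a). P t x \<xi> a) (fst z, \<xi> t, snd z)) \<in> borel \<Otimes>\<^sub>M borel \<rightarrow>\<^sub>M borel_weak"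
    by measurable
  then show ?thesis
    by (intro measurable_weak_imp_prob_algebra) (simp add: case_prod_beta)
qed

lemma policy_transition_measurable:
  assumes "t \<in> {1..T-1}"
  shows "(\<lambda>x. Q_kernel P t (\<pp> t x) x (\<xi> t)) \<in> borel \<rightarrow>\<^sub>M prob_algebra borel"
proof -
  note population_transition_measurable[OF assms, measurable]
  have [measurable]: "\<pp> t \<in> borel \<rightarrow>\<^sub>M prob_algebra borel"
    using policy_action_kernel[OF assms] unfolding action_kernels_def
    by (rule measurable_weak_imp_prob_algebra)
  show ?thesis unfolding Q_kernel_def by measurable
qed

lemma next_law_borel_probs:
  assumes "t \<in> {1..T-1}"
  shows "next_law P t (\<Psi> t) \<in> borel_probs"
proof -
  have 1: "\<Psi> t \<in> space (prob_algebra (borel \<Otimes>\<^sub>M borel))"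
    using flow_borel_probs[OF assms] unfolding borel_prod .
  show ?thesis
    unfolding next_law_def borel_probs_eq
    using prob_space_bind'[OF 1 population_transition_measurable[OF assms]]
      sets_bind'[OF 1 population_transition_measurable[OF assms]] by simp
qed

text \<open>The flow equation is written with the joint law \<open>\<Psi> t\<close>, the score bounds with the mixed kernel
  \<open>Q_kernel\<close>. Disintegrating \<open>\<Psi> t\<close> along the policy shows that averaging \<open>Q_kernel\<close> over the population
  is exactly one step of the flow, whichever version of the policy kernel is used.\<close>

lemma next_population:
  assumes t: "t \<in> {1..T-2}"
  shows "\<xi> (Suc t) = \<xi> t \<bind> (\<lambda>x. Q_kernel P t (\<pp> t x) x (\<xi> t))"
proof -
  have t': "t \<in> {1..T-1}" "Suc t \<in> {1..T-1}" using t by auto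
  have \<Psi>: "\<Psi> t \<in> space (prob_algebra (borel \<Otimes>\<^sub>M borel))"
    using flow_borel_probs[OF t'(1)] unfolding borel_prod .
  have "\<xi> (Suc t) = next_law P t (\<Psi> t)"
  proof (rule measure_eqI)
    show "sets (\<xi> (Suc t)) = sets (next_law P t (\<Psi> t))"
      using population_borel_probs[OF t'(2)] next_law_borel_probs[OF t'(1)] by (simp add: borel_probs_eq)
    fix B assume "B \<in> sets (\<xi> (Suc t))"
    then have B: "B \<in> sets borel" using population_borel_probs[OF t'(2)] by (simp add: borel_probs_eq)
    have "emeasure (next_law P t (\<Psi> t)) B = (\<integral>\<^sup>+z. emeasure ((\<lambda>(x, a). P t x (\<xi> t) a) z) B \<partial>\<Psi> t)"
      unfolding next_law_def
      by (rule emeasure_bind_prob_algebra[OF \<Psi> population_transition_measurable[OF t'(1)] B])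
    also have "\<dots> = emeasure (\<xi> (Suc t)) B"
      using flow t B unfolding mean_field_flow_def by (simp add: split_def)
    finally show "emeasure (\<xi> (Suc t)) B = emeasure (next_law P t (\<Psi> t)) B" ..
  qed
  also have "\<dots> = \<xi> t \<bind> (\<lambda>x. Q_kernel P t (\<pp> t x) x (\<xi> t))"
    unfolding next_law_def Q_kernel_def
    using flow_borel_probs t' induced population_transition_measurable
    by (intro bind_disintegration) blast+
  finally show ?thesis .
qed

lemma policy_transition_integral_bdd_borel:
  assumes t: "t \<in> {1..T-1}" and f: "f \<in> bdd_borel borel"
  shows "(\<lambda>x. \<integral>y. f y \<partial>Q_kernel P t (\<pp> t x) x (\<xi> t)) \<in> bdd_borel borel"
proof (rule bdd_borelI)
  have Q: "(\<lambda>x. Q_kernel P t (\<pp> t x) x (\<xi> t)) \<in> borel \<rightarrow>\<^sub>M subprob_algebra borel"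
    using policy_transition_measurable[OF t] by (rule measurable_prob_algebraD)
  show "(\<lambda>x. \<integral>y. f y \<partial>Q_kernel P t (\<pp> t x) x (\<xi> t)) \<in> borel_measurable borel"
    using f by (intro measurable_compose[OF Q integral_measurable_subprob_algebra]) (simp add: bdd_borel_def)
  show "\<bar>\<integral>y. f y \<partial>Q_kernel P t (\<pp> t x) x (\<xi> t)\<bar> \<le> sup_norm f" for x
  proof -
    have Qx: "Q_kernel P t (\<pp> t x) x (\<xi> t) \<in> borel_probs"
      using measurable_space[OF policy_transition_measurable[OF t], of x] by simp
    interpret prob_space "Q_kernel P t (\<pp> t x) x (\<xi> t)" using Qx by (simp add: borel_probs_eq)
    have int: "integrable (Q_kernel P t (\<pp> t x) x (\<xi> t)) f" by (rule integrable_bdd_borel[OF f Qx])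
    have "\<bar>\<integral>y. f y \<partial>Q_kernel P t (\<pp> t x) x (\<xi> t)\<bar> \<le> (\<integral>y. \<bar>f y\<bar> \<partial>Q_kernel P t (\<pp> t x) x (\<xi> t))"
      by (rule integral_abs_bound)
    also have "\<dots> \<le> (\<integral>y. sup_norm f \<partial>Q_kernel P t (\<pp> t x) x (\<xi> t))"
      by (rule integral_mono) (use int abs_le_sup_norm[OF f] in auto)
    finally show ?thesis by (simp add: prob_space)
  qed
qed

lemma integral_next_population:
  assumes t: "t \<in> {1..T-2}" and f: "f \<in> bdd_borel borel"
  shows "(\<integral>y. f y \<partial>\<xi> (Suc t)) = (\<integral>x. \<integral>y. f y \<partial>Q_kernel P t (\<pp> t x) x (\<xi> t) \<partial>\<xi> t)"
proof -
  have t': "t \<in> {1..T-1}" using t by auto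
  interpret prob_space "\<xi> t" using population_borel_probs[OF t'] by (simp add: borel_probs_eq)
  have sets_\<xi>: "sets (\<xi> t) = sets borel" using population_borel_probs[OF t'] by (simp add: borel_probs_eq)
  have Q: "(\<lambda>x. Q_kernel P t (\<pp> t x) x (\<xi> t)) \<in> \<xi> t \<rightarrow>\<^sub>M subprob_algebra borel"
    using measurable_prob_algebraD[OF policy_transition_measurable[OF t']]
    by (simp cong: measurable_cong_sets add: sets_\<xi>)
  have "emeasure (Q_kernel P t (\<pp> t x) x (\<xi> t)) (space (Q_kernel P t (\<pp> t x) x (\<xi> t))) \<le> ennreal 1" for x
    using prob_space.emeasure_space_1[of "Q_kernel P t (\<pp> t x) x (\<xi> t)"]
      measurable_space[OF policy_transition_measurable[OF t'], of x] by (simp add: borel_probs_eq)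
  then show ?thesis
    unfolding next_population[OF t]
    by (intro integral_bind[OF _ _ Q, where B="sup_norm f" and B'=1])
       (use f abs_le_sup_norm[OF f] in \<open>auto simp: bdd_borel_def finite_measure_axioms\<close>)
qed

lemma V_flow_bdd_borel: "V_flow T P \<Psi> V \<in> bdd_borel borel"
proof -
  let ?\<nu> = "next_law P (T - 1) (\<Psi> (T - 1))"
  have \<nu>: "?\<nu> \<in> space borel_weak"
    using next_law_borel_probs[of "T - 1"] horizon by simp
  have [measurable]: "V \<in> borel_measurable (borel \<Otimes>\<^sub>M borel_weak)"
    using terminal by (simp add: bdd_borel_def)
  have "(\<lambda>x. V (x, ?\<nu>)) \<in> borel_measurable borel"
    using \<nu> by measurable
  moreover obtain B where "\<And>z. z \<in> space (borel \<Otimes>\<^sub>M borel_weak) \<Longrightarrow> \<bar>V z\<bar> \<le> B"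
    using terminal by (auto simp: bdd_borel_def bounded_iff)
  ultimately show ?thesis
    unfolding V_flow_def using \<nu> by (intro bdd_borelI[where B=B]) (auto simp: space_pair_measure)
qed

lemma policy_value_step: "t < T \<Longrightarrow> policy_value t = S_op G t (\<pp> t) (\<xi> t) (policy_value (Suc t))"
  by (simp add: S_comp_def upt_conv_Cons)

lemma optimal_value_step: "t < T \<Longrightarrow> optimal_value t = S_star G t (\<xi> t) (optimal_value (Suc t))"
  by (simp add: S_star_comp_def upt_conv_Cons)

lemma value_final: "policy_value T = V_flow T P \<Psi> V" "optimal_value T = V_flow T P \<Psi> V"
  by (simp_all add: S_comp_def S_star_comp_def)

lemma value_bdd_borel:
  assumes "1 \<le> t" "t \<le> T"
  shows "policy_value t \<in> bdd_borel borel" "optimal_value t \<in> bdd_borel borel"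
  using assms(2,1)
proof (induction t rule: inc_induct)
  case base
  { case 1 show ?case by (simp add: value_final V_flow_bdd_borel) }
  { case 2 show ?case by (simp add: value_final V_flow_bdd_borel) }
next
  case (step t)
  { case 1
    then show ?case
      using step by (subst policy_value_step)
        (auto intro!: S_op_bdd_borel policy_action_kernel population_borel_probs) }
  { case 2
    then show ?case
      using step by (subst optimal_value_step)
        (auto intro!: S_star_bdd_borel population_borel_probs) }
qed

lemma S_op_mono:
  assumes "t \<in> {1..T-1}" "v \<in> bdd_borel borel" "w \<in> bdd_borel borel" "v \<le> w"
  shows "S_op G t (\<pp> t) (\<xi> t) v \<le> S_op G t (\<pp> t) (\<xi> t) w"
  using mono assms policy_borel_probs[OF assms(1)] population_borel_probs[OF assms(1)]
  unfolding monotonicity_def S_op_def le_fun_def by blast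

lemma S_star_le_S_op:
  assumes "t \<in> {1..T-1}" "v \<in> bdd_borel borel"
  shows "S_star G t (\<xi> t) v \<le> S_op G t (\<pp> t) (\<xi> t) v"
  unfolding S_op_def le_fun_def
  using assms policy_borel_probs population_borel_probs by (intro allI S_star_le_score) auto

lemma optimal_value_le_policy_value:
  assumes "1 \<le> t" "t \<le> T"
  shows "optimal_value t \<le> policy_value t"
  using assms(2,1)
proof (induction t rule: inc_induct)
  case base
  show ?case by (simp add: value_final)
next
  case (step t)
  then have t: "t \<in> {1..T-1}" and "t < T" and le: "optimal_value (Suc t) \<le> policy_value (Suc t)" by auto
  note bdd = value_bdd_borel[of "Suc t"]
  have "optimal_value t \<le> S_op G t (\<pp> t) (\<xi> t) (optimal_value (Suc t))"
    unfolding optimal_value_step[OF \<open>t < T\<close>]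
    by (rule S_star_le_S_op[OF t]) (use bdd \<open>t < T\<close> in simp)
  also have "\<dots> \<le> policy_value t"
    unfolding policy_value_step[OF \<open>t < T\<close>]
    by (rule S_op_mono[OF t _ _ le]) (use bdd \<open>t < T\<close> in simp_all)
  finally show ?case .
qed

lemma step_regret_nonneg:
  assumes t: "t \<in> {1..T-1}"
  shows "step_regret t \<ge> 0"
proof -
  have "t < T" using t by auto
  have "optimal_value t \<le> S_op G t (\<pp> t) (\<xi> t) (optimal_value (t + 1))"
    using S_star_le_S_op[OF t, of "optimal_value (Suc t)"] value_bdd_borel[of "Suc t"] \<open>t < T\<close>
    by (simp add: optimal_value_step)
  then show ?thesis
    unfolding step_regret_def le_fun_def by (intro Bochner_Integration.integral_nonneg) simp
qed

text \<open>Insert the value of playing the policy in period \<open>t\<close> and optimally afterwards: the first summand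
  compares one operator at two continuations, the second two operators at one continuation.\<close>

lemma value_gap_split:
  assumes t: "t \<in> {1..T-1}"
  shows "value_gap t = (\<integral>x. S_op G t (\<pp> t) (\<xi> t) (policy_value (Suc t)) x
      - S_op G t (\<pp> t) (\<xi> t) (optimal_value (Suc t)) x \<partial>\<xi> t) + step_regret t"
proof -
  have "t < T" using t by auto
  have \<xi>: "\<xi> t \<in> borel_probs" using population_borel_probs[OF t] .
  have int: "integrable (\<xi> t) (S_op G t (\<pp> t) (\<xi> t) (policy_value (Suc t)))"
    "integrable (\<xi> t) (S_op G t (\<pp> t) (\<xi> t) (optimal_value (Suc t)))"
    "integrable (\<xi> t) (optimal_value t)"
    using \<open>t < T\<close> t
    by (auto intro!: integrable_bdd_borel S_op_bdd_borel policy_action_kernel \<xi> value_bdd_borel)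
  show ?thesis
    unfolding value_gap_def step_regret_def policy_value_step[OF \<open>t < T\<close>]
    using int by simp
qed

lemma value_gap_last: "value_gap (T - 1) = step_regret (T - 1)"
  using value_gap_split[of "T - 1"] horizon by (simp add: value_final)

text \<open>The pointwise integral bound involves \<open>Q_kernel\<close> from the state \<open>x\<close>; integrated over the
  population it becomes an integral over the next population, so the gap at \<open>t\<close> is controlled by the
  gap at \<open>t + 1\<close>.\<close>

lemma integral_S_op_diff_le:
  assumes "integral_bound T P \<xi>0 G0 G c" and t: "t \<in> {1..T-2}"
    and v: "v \<in> bdd_borel borel" and w: "w \<in> bdd_borel borel" and "w \<le> v"
  shows "(\<integral>x. S_op G t (\<pp> t) (\<xi> t) v x - S_op G t (\<pp> t) (\<xi> t) w x \<partial>\<xi> t)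
    \<le> c * (\<integral>y. v y - w y \<partial>\<xi> (Suc t))"
proof -
  have t': "t \<in> {1..T-1}" using t by auto
  note \<xi> = population_borel_probs[OF t']
  have diff: "(\<lambda>y. v y - w y) \<in> bdd_borel borel" by (rule bdd_borel_diff[OF v w])
  have "(\<integral>x. S_op G t (\<pp> t) (\<xi> t) v x - S_op G t (\<pp> t) (\<xi> t) w x \<partial>\<xi> t)
      \<le> (\<integral>x. c * (\<integral>y. v y - w y \<partial>Q_kernel P t (\<pp> t x) x (\<xi> t)) \<partial>\<xi> t)"
  proof (rule integral_mono)
    show "integrable (\<xi> t) (\<lambda>x. S_op G t (\<pp> t) (\<xi> t) v x - S_op G t (\<pp> t) (\<xi> t) w x)"
      by (intro integrable_bdd_borel bdd_borel_diff S_op_bdd_borel t' policy_action_kernel \<xi> v w)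
    show "integrable (\<xi> t) (\<lambda>x. c * (\<integral>y. v y - w y \<partial>Q_kernel P t (\<pp> t x) x (\<xi> t)))"
      by (intro integrable_mult_right integrable_bdd_borel policy_transition_integral_bdd_borel t' diff \<xi>)
    fix x
    have "\<bar>G t (\<pp> t x) (\<xi> t) v x - G t (\<pp> t x) (\<xi> t) w x\<bar>
        \<le> c * (\<integral>y. \<bar>v y - w y\<bar> \<partial>Q_kernel P t (\<pp> t x) x (\<xi> t))"
      using assms(1) t' v w \<xi> policy_borel_probs[OF t'] unfolding integral_bound_def by blast
    moreover have "\<bar>v y - w y\<bar> = v y - w y" for y
      using \<open>w \<le> v\<close> by (simp add: le_fun_def)
    ultimately show "S_op G t (\<pp> t) (\<xi> t) v x - S_op G t (\<pp> t) (\<xi> t) w x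
        \<le> c * (\<integral>y. v y - w y \<partial>Q_kernel P t (\<pp> t x) x (\<xi> t))"
      by (simp add: S_op_def)
  qed
  also have "\<dots> = c * (\<integral>y. v y - w y \<partial>\<xi> (Suc t))"
    by (simp add: integral_next_population[OF t diff])
  finally show ?thesis .
qed

lemma integral_S_op_diff_ge:
  assumes "integral_lower_bound T P \<xi>0 G0 G c" and t: "t \<in> {1..T-2}"
    and v: "v \<in> bdd_borel borel" and w: "w \<in> bdd_borel borel" and "w \<le> v"
  shows "(\<integral>x. S_op G t (\<pp> t) (\<xi> t) v x - S_op G t (\<pp> t) (\<xi> t) w x \<partial>\<xi> t)
    \<ge> c * (\<integral>y. v y - w y \<partial>\<xi> (Suc t))"
proof -
  have t': "t \<in> {1..T-1}" using t by auto
  note \<xi> = population_borel_probs[OF t']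
  have diff: "(\<lambda>y. v y - w y) \<in> bdd_borel borel" by (rule bdd_borel_diff[OF v w])
  have "c * (\<integral>y. v y - w y \<partial>\<xi> (Suc t))
      = (\<integral>x. c * (\<integral>y. v y - w y \<partial>Q_kernel P t (\<pp> t x) x (\<xi> t)) \<partial>\<xi> t)"
    by (simp add: integral_next_population[OF t diff])
  also have "\<dots> \<le> (\<integral>x. S_op G t (\<pp> t) (\<xi> t) v x - S_op G t (\<pp> t) (\<xi> t) w x \<partial>\<xi> t)"
  proof (rule integral_mono)
    show "integrable (\<xi> t) (\<lambda>x. S_op G t (\<pp> t) (\<xi> t) v x - S_op G t (\<pp> t) (\<xi> t) w x)"
      by (intro integrable_bdd_borel bdd_borel_diff S_op_bdd_borel t' policy_action_kernel \<xi> v w)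
    show "integrable (\<xi> t) (\<lambda>x. c * (\<integral>y. v y - w y \<partial>Q_kernel P t (\<pp> t x) x (\<xi> t)))"
      by (intro integrable_mult_right integrable_bdd_borel policy_transition_integral_bdd_borel t' diff \<xi>)
    show "c * (\<integral>y. v y - w y \<partial>Q_kernel P t (\<pp> t x) x (\<xi> t))
        \<le> S_op G t (\<pp> t) (\<xi> t) v x - S_op G t (\<pp> t) (\<xi> t) w x" for x
      using assms(1) t' v w \<xi> policy_borel_probs[OF t'] \<open>w \<le> v\<close>
      unfolding integral_lower_bound_def S_op_def by blast
  qed
  finally show ?thesis .
qed

lemma stepwise_exploitability_eq:
  "stepwise_exploitability c T P G \<pp> \<Psi> V = (\<Sum>t=1..T-1. c ^ t * step_regret t)"
  by (simp add: stepwise_exploitability_def step_regret_def)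

lemma exploitability_eq:
  "exploitability T P G0 G \<pp> \<Psi> V = G0 (policy_value 1) - G0 (optimal_value 1)"
  by (simp add: exploitability_def total_score_def optimal_score_def)

lemma initial_law: "\<xi> 1 = \<xi>0"
  using flow unfolding mean_field_flow_def by blast

lemma exploitability_le:
  assumes bound: "integral_bound T P \<xi>0 G0 G c"
  shows "exploitability T P G0 G \<pp> \<Psi> V \<le> stepwise_exploitability c T P G \<pp> \<Psi> V"
proof -
  have "c > 0" using bound by (simp add: integral_bound_def)
  have bdd: "policy_value 1 \<in> bdd_borel borel" "optimal_value 1 \<in> bdd_borel borel"
    using value_bdd_borel[of 1] horizon by simp_all
  have abs: "\<bar>policy_value 1 y - optimal_value 1 y\<bar> = policy_value 1 y - optimal_value 1 y" for y
    using optimal_value_le_policy_value[of 1] horizon by (simp add: le_fun_def)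
  have "\<bar>G0 (policy_value 1) - G0 (optimal_value 1)\<bar>
      \<le> c * (\<integral>y. \<bar>policy_value 1 y - optimal_value 1 y\<bar> \<partial>\<xi>0)"
    using bound bdd unfolding integral_bound_def by blast
  then have "exploitability T P G0 G \<pp> \<Psi> V \<le> c ^ 1 * value_gap 1"
    unfolding exploitability_eq value_gap_def abs initial_law by simp
  also have "\<dots> \<le> (\<Sum>t=1..T-1. c ^ t * step_regret t)"
  proof (rule telescoped_upper_bound)
    show "value_gap t \<le> c * value_gap (Suc t) + step_regret t" if "1 \<le> t" "t < T - 1" for t
      using that value_gap_split[of t] optimal_value_le_policy_value[of "Suc t"]
        integral_S_op_diff_le[OF bound, of t "policy_value (Suc t)" "optimal_value (Suc t)"]
        value_bdd_borel[of "Suc t"]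
      by (simp add: value_gap_def[of "Suc t"])
  qed (use \<open>c > 0\<close> horizon value_gap_last in auto)
  finally show ?thesis by (simp add: stepwise_exploitability_eq)
qed

text \<open>The lower integral bound reverses every estimate of the previous argument, with its own constant
  in the weights.\<close>

lemma power_weighted_exploitability_ge:
  assumes bound: "integral_lower_bound T P \<xi>0 G0 G c"
  shows "exploitability T P G0 G \<pp> \<Psi> V \<ge> (\<Sum>t=1..T-1. c ^ t * step_regret t)"
proof -
  have "c > 0" using bound by (simp add: integral_lower_bound_def)
  have bdd: "policy_value 1 \<in> bdd_borel borel" "optimal_value 1 \<in> bdd_borel borel"
    using value_bdd_borel[of 1] horizon by simp_all
  have "(\<Sum>t=1..T-1. c ^ t * step_regret t) \<le> c ^ 1 * value_gap 1"
  proof (rule telescoped_lower_bound)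
    show "c * value_gap (Suc t) + step_regret t \<le> value_gap t" if "1 \<le> t" "t < T - 1" for t
      using that value_gap_split[of t] optimal_value_le_policy_value[of "Suc t"]
        integral_S_op_diff_ge[OF bound, of t "policy_value (Suc t)" "optimal_value (Suc t)"]
        value_bdd_borel[of "Suc t"]
      by (simp add: value_gap_def[of "Suc t"])
  qed (use \<open>c > 0\<close> horizon value_gap_last in auto)
  also have "\<dots> \<le> G0 (policy_value 1) - G0 (optimal_value 1)"
    using bound bdd optimal_value_le_policy_value[of 1] horizon
    unfolding integral_lower_bound_def value_gap_def initial_law by simp
  finally show ?thesis by (simp add: exploitability_eq)
qed

text \<open>Both bounds on the initial score operator apply to the constants \<open>1\<close> and \<open>0\<close>, where they sandwich
  the same increment.\<close>

lemma lower_constant_le_upper_constant: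
  assumes "integral_bound T P \<xi>0 G0 G cbar" "integral_lower_bound T P \<xi>0 G0 G cund"
  shows "cund \<le> cbar"
proof -
  have "\<xi> 1 \<in> borel_probs" using population_borel_probs[of 1] horizon by simp
  then interpret prob_space \<xi>0 unfolding initial_law by (simp add: borel_probs_eq)
  have const: "(\<lambda>_::'x. r) \<in> bdd_borel borel" for r :: real
    by (rule bdd_borelI[where B="\<bar>r\<bar>"]) auto
  have "\<bar>G0 (\<lambda>_. 1) - G0 (\<lambda>_. 0)\<bar> \<le> cbar * (\<integral>y. \<bar>1 - 0\<bar> \<partial>\<xi>0)"
    using assms(1) const[of 1] const[of 0] unfolding integral_bound_def by blast
  moreover have "(\<lambda>_::'x. 0::real) \<le> (\<lambda>_. 1)" by (simp add: le_fun_def)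
  then have "G0 (\<lambda>_. 1) - G0 (\<lambda>_. 0) \<ge> cund * (\<integral>y. 1 - 0 \<partial>\<xi>0)"
    using assms(2) const[of 1] const[of 0] unfolding integral_lower_bound_def by blast
  ultimately show ?thesis by (simp add: prob_space)
qed

text \<open>Since \<open>cund / cbar \<le> 1\<close>, its power \<open>T - 1\<close> is at most its power \<open>t\<close> for every period, which
  converts the weights \<open>cund ^ t\<close> into multiples of \<open>cbar ^ t\<close>; nonnegative regrets allow the
  replacement term by term.\<close>

lemma exploitability_ge:
  assumes upper: "integral_bound T P \<xi>0 G0 G cbar" and lower: "integral_lower_bound T P \<xi>0 G0 G cund"
  shows "exploitability T P G0 G \<pp> \<Psi> V
    \<ge> (cund / cbar) ^ (T - 1) * stepwise_exploitability cbar T P G \<pp> \<Psi> V"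
proof -
  have pos: "cbar > 0" "cund > 0"
    using upper lower by (simp_all add: integral_bound_def integral_lower_bound_def)
  have ratio: "0 \<le> cund / cbar" "cund / cbar \<le> 1"
    using pos lower_constant_le_upper_constant[OF upper lower] by simp_all
  have "(cund / cbar) ^ (T - 1) * stepwise_exploitability cbar T P G \<pp> \<Psi> V
      = (\<Sum>t=1..T-1. (cund / cbar) ^ (T - 1) * (cbar ^ t * step_regret t))"
    by (simp add: stepwise_exploitability_eq sum_distrib_left)
  also have "\<dots> \<le> (\<Sum>t=1..T-1. cund ^ t * step_regret t)"
  proof (rule sum_mono)
    fix t assume t: "t \<in> {1..T-1}"
    have "(cund / cbar) ^ (T - 1) \<le> (cund / cbar) ^ t"
      using t ratio by (intro power_decreasing) auto
    then have "(cund / cbar) ^ (T - 1) * (cbar ^ t * step_regret t)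
        \<le> (cund / cbar) ^ t * (cbar ^ t * step_regret t)"
      using pos step_regret_nonneg[OF t] by (intro mult_right_mono) auto
    also have "\<dots> = cund ^ t * step_regret t"
      using pos by (simp add: power_divide)
    finally show "(cund / cbar) ^ (T - 1) * (cbar ^ t * step_regret t) \<le> cund ^ t * step_regret t" .
  qed
  also have "\<dots> \<le> exploitability T P G0 G \<pp> \<Psi> V"
    by (rule power_weighted_exploitability_ge[OF lower])
  finally show ?thesis .
qed

end

theorem proposition4p5:
  fixes T :: nat
    and P :: "('x::polish_space, 'a::polish_space) transition"
    and \<xi>0 :: "'x measure"
    and G :: "('x, 'a) score"
    and G0 :: "('x \<Rightarrow> real) \<Rightarrow> real"
    and c0 c1 :: real
    and \<Psi> :: "nat \<Rightarrow> ('x \<times> 'a) measure"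
    and \<pp> :: "nat \<Rightarrow> 'x \<Rightarrow> 'a measure"
    and V :: "'x \<times> 'x measure \<Rightarrow> real"
  assumes "T \<ge> 2"
    and "transition_kernels T P"
    and "\<xi>0 \<in> borel_probs"
    and "score_operators T G"
    and "compact (UNIV :: 'a set)"
    and "monotonicity T G0 G"
    and "growth_bound T G c0 c1"
    and "score_continuity T G c0 c1"
    and "mean_field_flow T P \<xi>0 \<Psi>"
    and "\<forall>t\<in>{1..T-1}. induced_kernel (\<Psi> t) (\<pp> t)"
    and "V \<in> bdd_borel (borel \<Otimes>\<^sub>M borel_weak)"
  shows "(\<forall>cbar. integral_bound T P \<xi>0 G0 G cbar \<longrightarrow>
            exploitability T P G0 G \<pp> \<Psi> V \<le> stepwise_exploitability cbar T P G \<pp> \<Psi> V)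
       \<and> (\<forall>cbar cund. integral_bound T P \<xi>0 G0 G cbar \<and> integral_lower_bound T P \<xi>0 G0 G cund \<longrightarrow>
            exploitability T P G0 G \<pp> \<Psi> V
              \<ge> (cund / cbar) ^ (T - 1) * stepwise_exploitability cbar T P G \<pp> \<Psi> V)"
proof -
  interpret mean_field_problem T G c0 c1 P \<xi>0 G0 \<Psi> \<pp> V
    using assms by unfold_locales
  show ?thesis using exploitability_le exploitability_ge by blast
qed

end
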